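(* Let $X,Y$ be compact Hausdorff spaces. Given a continuous map $h:X\to Y$ and a continuous $n$-transfer $\tau:C(X)\to C(Y)$ for the ring homomorphism $h^*:C(Y)\to C(X)$, $h^*(\psi)=\psi\circ h$, the map $h$ is an $n$-branched covering.
   Context: $\mathrm{Sym}^n(X)=X^n/\Sigma_n$ is the $n$-th symmetric product (with the quotient topology); its points are $n$-multisets $[x_1,\dots,x_n]$ of points of $X$. A continuous map $h:X\to Y$ induces $\mathrm{Sym}^n(h):\mathrm{Sym}^n(X)\to\mathrm{Sym}^n(Y)$, $[x_1,\dots,x_n]\mapsto[h(x_1),\dots,h(x_n)]$. A continuous map $h:X\to Y$ between Hausdorff spaces is an $n$-branched covering if there is a continuous map $t:Y\to\mathrm{Sym}^n(X)$ such that (i) $x\in t(h(x))$ for every $x\in X$; (ii) $\mathrm{Sym}^n(h)(t(y))=ny$ for every $y\in Y$, where $ny=[y,\dots,y]$ denotes the multiset consisting of $y$ with multiplicity $n$. $C(X)$ is the algebra of continuous functions $X\to\mathbb{C}$ with the supremum norm; continuity of $\tau$ is with respect to these norms. All algebras are commutative, associative, unital $\mathbb{C}$-algebras. For a linear map $f:A\to B$ and $n\ge1$, define $\Phi_n(f):A^{\otimes n}\to B$ by $\Phi_n(f)(a_1,\dots,a_n)=\sum_{\sigma\in\Sigma_n}\varepsilon_\sigma f_{\gamma_1}(a_1,\dots,a_n)\cdots f_{\gamma_r}(a_1,\dots,a_n)$, where $\sigma=\gamma_1\cdots\gamma_r$ is the decomposition into disjoint cycles of total length $n$ (cycles of length 1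 included), $\varepsilon_\sigma$ is the sign of $\sigma$, and $f_\gamma(a_1,\dots,a_n)=f(a_{i_1}a_{i_2}\cdots a_{i_m})$ for a cycle $\gamma=(i_1\dots i_m)$. A linear map $f:A\to B$ is a Frobenius $n$-homomorphism if $f(1)=n$ and $\Phi_{n+1}(f)\equiv0$ (for $n=0$ this means $f=0$). $n$-transfer: for a ring homomorphism $f:A\to B$, a linear map $\tau:B\to A$ is an $n$-transfer for $f$ if (i) $\tau$ is a Frobenius $n$-homomorphism; (ii) $\tau(f(a)b)=a\tau(b)$ for all $a\in A$, $b\in B$; (iii) $f\tau:B\to B$ is the sum of the identity and a Frobenius $(n-1)$-homomorphism $g:B\to B$. *)

theory Defs
  imports
    "HOL-Analysis.Urysohn"
    "HOL-Library.Multiset"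
    "HOL-Combinatorics.Permutations"
    "HOL-Combinatorics.Orbits"
    "HOL-Algebra.Module"
begin

section \<open>Symmetric products and branched coverings\<close>

definition tuple_mset :: "nat \<Rightarrow> (nat \<Rightarrow> 'a) \<Rightarrow> 'a multiset" where
  "tuple_mset n x = image_mset x (mset_set {..<n})"

text \<open>Two tuples lie in the same orbit of the symmetric group iff they have the same multiset of
  entries, so the quotient of \<open>X\<^sup>n\<close> is realised on multisets of size \<open>n\<close>, with the
  quotient topology of \<^term>\<open>tuple_mset n\<close>.\<close>

definition Sym :: "nat \<Rightarrow> 'a topology \<Rightarrow> 'a multiset topology" where
  "Sym n X = topology (\<lambda>U. U \<subseteq> {M. size M = n \<and> set_mset M \<subseteq> topspace X} \<and>
     openin (product_topology (\<lambda>_. X) {..<n})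
       {x \<in> topspace (product_topology (\<lambda>_. X) {..<n}). tuple_mset n x \<in> U})"

lemma openin_Sym:
  "openin (Sym n X) U \<longleftrightarrow> U \<subseteq> {M. size M = n \<and> set_mset M \<subseteq> topspace X} \<and>
     openin (product_topology (\<lambda>_. X) {..<n})
       {x \<in> topspace (product_topology (\<lambda>_. X) {..<n}). tuple_mset n x \<in> U}"
proof -
  let ?P = "product_topology (\<lambda>_. X) {..<n}"
  have "istopology (\<lambda>U. U \<subseteq> {M. size M = n \<and> set_mset M \<subseteq> topspace X} \<and>
          openin ?P {x \<in> topspace ?P. tuple_mset n x \<in> U})"
    unfolding istopology_def
  proof (intro conjI allI impI; (elim conjE)?)
    fix S T
    assume "openin ?P {x \<in> topspace ?P. tuple_mset n x \<in> S}"
      "openin ?P {x \<in> topspace ?P. tuple_mset n x \<in> T}"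
    then have "openin ?P ({x \<in> topspace ?P. tuple_mset n x \<in> S}
        \<inter> {x \<in> topspace ?P. tuple_mset n x \<in> T})"
      by (rule openin_Int)
    also have "{x \<in> topspace ?P. tuple_mset n x \<in> S} \<inter> {x \<in> topspace ?P. tuple_mset n x \<in> T}
        = {x \<in> topspace ?P. tuple_mset n x \<in> S \<inter> T}"
      by blast
    finally show "openin ?P {x \<in> topspace ?P. tuple_mset n x \<in> S \<inter> T}" .
  next
    fix \<K>
    assume *: "\<forall>K\<in>\<K>. K \<subseteq> {M. size M = n \<and> set_mset M \<subseteq> topspace X} \<and>
          openin ?P {x \<in> topspace ?P. tuple_mset n x \<in> K}"
    then have "openin ?P (\<Union>K\<in>\<K>. {x \<in> topspace ?P. tuple_mset n x \<in> K})"
      by blast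
    also have "(\<Union>K\<in>\<K>. {x \<in> topspace ?P. tuple_mset n x \<in> K})
        = {x \<in> topspace ?P. tuple_mset n x \<in> \<Union>\<K>}"
      by blast
    finally show "openin ?P {x \<in> topspace ?P. tuple_mset n x \<in> \<Union>\<K>}" .
  qed blast+
  then show ?thesis
    unfolding Sym_def by simp
qed

lemma size_tuple_mset [simp]: "size (tuple_mset n x) = n"
  by (simp add: tuple_mset_def)

lemma set_tuple_mset [simp]: "set_mset (tuple_mset n x) = x ` {..<n}"
  by (simp add: tuple_mset_def)

lemma topspace_Sym: "topspace (Sym n X) = {M. size M = n \<and> set_mset M \<subseteq> topspace X}"
proof -
  have "openin (Sym n X) {M. size M = n \<and> set_mset M \<subseteq> topspace X}"
  proof -
    have "{x \<in> topspace (product_topology (\<lambda>_. X) {..<n}).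
             tuple_mset n x \<in> {M. size M = n \<and> set_mset M \<subseteq> topspace X}}
          = topspace (product_topology (\<lambda>_. X) {..<n})"
      by (auto simp: PiE_def Pi_def)
    then show ?thesis
      unfolding openin_Sym by (intro conjI order_refl) (simp only: openin_topspace)
  qed
  then have "{M. size M = n \<and> set_mset M \<subseteq> topspace X} \<subseteq> topspace (Sym n X)"
    by (rule openin_subset)
  moreover have "topspace (Sym n X) \<subseteq> {M. size M = n \<and> set_mset M \<subseteq> topspace X}"
    using openin_topspace[of "Sym n X"] by (simp only: openin_Sym)
  ultimately show ?thesis
    by (rule equalityI[rotated])
qed

lemma quotient_map_Sym:
  "quotient_map (product_topology (\<lambda>_. X) {..<n}) (Sym n X) (tuple_mset n)"
  unfolding quotient_map_def
proof (intro conjI allI impI)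
  show "tuple_mset n ` topspace (product_topology (\<lambda>_. X) {..<n}) = topspace (Sym n X)"
  proof (intro equalityI subsetI)
    fix M assume "M \<in> topspace (Sym n X)"
    then have M: "size M = n" "set_mset M \<subseteq> topspace X"
      by (auto simp: topspace_Sym)
    obtain xs where xs: "mset xs = M"
      using ex_mset by blast
    define x where "x = restrict (\<lambda>i. xs ! i) {..<n}"
    have len: "length xs = n"
      using M xs by auto
    have "tuple_mset n x = image_mset (\<lambda>i. xs ! i) (mset_set {..<n})"
      unfolding tuple_mset_def by (rule image_mset_cong) (simp add: x_def)
    also have "\<dots> = mset (map (\<lambda>i. xs ! i) [0..<n])"
      by (simp add: lessThan_atLeast0)
    also have "\<dots> = M"
      using xs len map_nth by metis
    finally have "tuple_mset n x = M" .
    moreover have "x \<in> topspace (product_topology (\<lambda>_. X) {..<n})"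
      using M xs len by (auto simp: x_def)
    ultimately show "M \<in> tuple_mset n ` topspace (product_topology (\<lambda>_. X) {..<n})"
      by blast
  qed (auto simp: topspace_Sym PiE_def Pi_def)
next
  fix U assume "U \<subseteq> topspace (Sym n X)"
  then show "openin (product_topology (\<lambda>_. X) {..<n})
      {x \<in> topspace (product_topology (\<lambda>_. X) {..<n}). tuple_mset n x \<in> U} =
      openin (Sym n X) U"
    by (simp add: openin_Sym topspace_Sym)
qed

definition Sym_map :: "('a \<Rightarrow> 'b) \<Rightarrow> 'a multiset \<Rightarrow> 'b multiset" where
  "Sym_map h = image_mset h"

definition branched_covering :: "nat \<Rightarrow> 'a topology \<Rightarrow> 'b topology \<Rightarrow> ('a \<Rightarrow> 'b) \<Rightarrow> bool" where
  "branched_covering n X Y h \<longleftrightarrow>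
     Hausdorff_space X \<and> Hausdorff_space Y \<and> continuous_map X Y h \<and>
     (\<exists>t. continuous_map Y (Sym n X) t \<and>
          (\<forall>x \<in> topspace X. x \<in># t (h x)) \<and>
          (\<forall>y \<in> topspace Y. Sym_map h (t y) = replicate_mset n y))"

section \<open>Frobenius homomorphisms and transfers\<close>

definition complex_ring :: "complex ring" where
  "complex_ring = \<lparr> carrier = UNIV, mult = (*), one = 1, zero = 0, add = (+) \<rparr>"

lemma cring_complex_ring: "cring complex_ring"
proof (rule cringI)
  show "abelian_group complex_ring"
  proof (rule abelian_groupI)
    show "\<exists>y \<in> carrier complex_ring. y \<oplus>\<^bsub>complex_ring\<^esub> x = \<zero>\<^bsub>complex_ring\<^esub>" for x
      by (rule bexI[of _ "- x"]) (simp_all add: complex_ring_def)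
  qed (simp_all add: complex_ring_def)
  show "comm_monoid complex_ring"
    by (rule comm_monoidI) (simp_all add: complex_ring_def)
qed (simp add: complex_ring_def distrib_right)

text \<open>A commutative unital complex algebra is a structure \<open>A\<close> satisfying
  \<^term>\<open>Module.algebra complex_ring A\<close>.\<close>

definition linear_map ::
  "(complex, 'a, 'k) module_scheme \<Rightarrow> (complex, 'b, 'l) module_scheme \<Rightarrow> ('a \<Rightarrow> 'b) \<Rightarrow> bool" where
  "linear_map A B f \<longleftrightarrow> f \<in> carrier A \<rightarrow> carrier B \<and>
     (\<forall>x \<in> carrier A. \<forall>y \<in> carrier A. f (x \<oplus>\<^bsub>A\<^esub> y) = f x \<oplus>\<^bsub>B\<^esub> f y) \<and>
     (\<forall>c. \<forall>x \<in> carrier A. f (c \<odot>\<^bsub>A\<^esub> x) = c \<odot>\<^bsub>B\<^esub> f x)"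

text \<open>The cycles of a permutation of \<open>{..<n}\<close>, fixed points included, are given by its orbits;
  by commutativity \<open>f (a\<^sub>i\<^sub>1 \<cdots> a\<^sub>i\<^sub>m)\<close> depends only on the underlying set of the cycle. Being
  multilinear, \<open>\<Phi>\<^sub>n(f)\<close> is given on tuples, that is on pure tensors.\<close>

definition Frobenius_Phi ::
  "(complex, 'a, 'k) module_scheme \<Rightarrow> (complex, 'b, 'l) module_scheme \<Rightarrow> nat \<Rightarrow>
   ('a \<Rightarrow> 'b) \<Rightarrow> (nat \<Rightarrow> 'a) \<Rightarrow> 'b" where
  "Frobenius_Phi A B n f a =
     (\<Oplus>\<^bsub>B\<^esub>\<sigma> \<in> {\<sigma>. \<sigma> permutes {..<n}}.
        complex_of_int (sign \<sigma>) \<odot>\<^bsub>B\<^esub> (\<Otimes>\<^bsub>B\<^esub>\<gamma> \<in> orbit \<sigma> ` {..<n}. f (\<Otimes>\<^bsub>A\<^esub>i \<in> \<gamma>. a i)))"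

definition Frobenius_hom ::
  "nat \<Rightarrow> (complex, 'a, 'k) module_scheme \<Rightarrow> (complex, 'b, 'l) module_scheme \<Rightarrow>
   ('a \<Rightarrow> 'b) \<Rightarrow> bool" where
  "Frobenius_hom n A B f \<longleftrightarrow> linear_map A B f \<and>
     f \<one>\<^bsub>A\<^esub> = of_nat n \<odot>\<^bsub>B\<^esub> \<one>\<^bsub>B\<^esub> \<and>
     (\<forall>a \<in> {..<Suc n} \<rightarrow> carrier A. Frobenius_Phi A B (Suc n) f a = \<zero>\<^bsub>B\<^esub>)"

text \<open>For \<open>n = 0\<close> the general condition already says that \<open>f\<close> vanishes.\<close>

lemma Frobenius_hom_0:
  assumes "Module.algebra complex_ring A"
    and "Module.algebra complex_ring B"
  shows "Frobenius_hom 0 A B f \<longleftrightarrow> (\<forall>x \<in> carrier A. f x = \<zero>\<^bsub>B\<^esub>)"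
proof -
  interpret A: Module.algebra complex_ring A by fact
  interpret B: Module.algebra complex_ring B by fact
  note finprod_A = comm_monoid.finprod_insert[OF cring.axioms(2)[OF A.M_cring]]
    and finprod_B = comm_monoid.finprod_insert[OF cring.axioms(2)[OF B.M_cring]]
    and finsum_B = abelian_monoid.finsum_insert[OF abelian_group.axioms(1)[OF B.abelian_group_axioms]]
  have smult0: "0 \<odot>\<^bsub>B\<^esub> x = \<zero>\<^bsub>B\<^esub>" if "x \<in> carrier B" for x
    using B.smult_l_null[OF that] by (simp add: complex_ring_def)
  have smult1: "1 \<odot>\<^bsub>B\<^esub> x = x" if "x \<in> carrier B" for x
    using B.smult_one[OF that] by (simp add: complex_ring_def)
  have smult_zero: "c \<odot>\<^bsub>B\<^esub> \<zero>\<^bsub>B\<^esub> = \<zero>\<^bsub>B\<^esub>" for c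
    using B.smult_r_null[of c] by (simp add: complex_ring_def)
  have smult_A: "c \<odot>\<^bsub>A\<^esub> x \<in> carrier A" if "x \<in> carrier A" for c x
    using A.smult_closed[of c x] that by (simp add: complex_ring_def)
  have Phi1: "Frobenius_Phi A B (Suc 0) f a = f (a 0)"
    if f: "f \<in> carrier A \<rightarrow> carrier B" and a: "a 0 \<in> carrier A" for a
  proof -
    have perms: "{\<sigma>. \<sigma> permutes {..<Suc 0}} = {id}"
      by (auto simp: lessThan_Suc permutes_id)
    have orb: "orbit id ` {..<Suc 0} = {{0::nat}}"
      by (auto simp: lessThan_Suc orbit_altdef)
    have "f (a 0) \<in> carrier B"
      using f a by blast
    moreover have "(\<Otimes>\<^bsub>A\<^esub>i \<in> {0}. a i) = a 0"
      using a finprod_A[of "{}" 0 a] by simp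
    ultimately have inner:
      "(\<Otimes>\<^bsub>B\<^esub>\<gamma> \<in> orbit id ` {..<Suc 0}. f (\<Otimes>\<^bsub>A\<^esub>i \<in> \<gamma>. a i)) = f (a 0)"
      using finprod_B[of "{}" "{0}" "\<lambda>\<gamma>. f (\<Otimes>\<^bsub>A\<^esub>i \<in> \<gamma>. a i)"] unfolding orb by simp
    define F where "F \<sigma> = complex_of_int (sign \<sigma>) \<odot>\<^bsub>B\<^esub>
        (\<Otimes>\<^bsub>B\<^esub>\<gamma> \<in> orbit \<sigma> ` {..<Suc 0}. f (\<Otimes>\<^bsub>A\<^esub>i \<in> \<gamma>. a i))" for \<sigma>
    have F_id: "F id = f (a 0)"
      using \<open>f (a 0) \<in> carrier B\<close> unfolding F_def inner sign_id by (simp add: smult1)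
    have "Frobenius_Phi A B (Suc 0) f a = (\<Oplus>\<^bsub>B\<^esub>\<sigma> \<in> {id}. F \<sigma>)"
      unfolding Frobenius_Phi_def perms F_def ..
    also have "\<dots> = F id"
      using finsum_B[of "{}" id F] F_id \<open>f (a 0) \<in> carrier B\<close> by simp
    finally show ?thesis
      using F_id by simp
  qed
  show ?thesis
  proof
    assume F: "Frobenius_hom 0 A B f"
    show "\<forall>x \<in> carrier A. f x = \<zero>\<^bsub>B\<^esub>"
    proof
      fix x assume x: "x \<in> carrier A"
      have "f \<in> carrier A \<rightarrow> carrier B"
        using F by (simp add: Frobenius_hom_def linear_map_def)
      from Phi1[OF this, of "\<lambda>_. x"] show "f x = \<zero>\<^bsub>B\<^esub>"
        using F x by (auto simp: Frobenius_hom_def)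
    qed
  next
    assume 0: "\<forall>x \<in> carrier A. f x = \<zero>\<^bsub>B\<^esub>"
    then have f: "f \<in> carrier A \<rightarrow> carrier B"
      by auto
    have "linear_map A B f"
      using 0 by (auto simp: linear_map_def smult_zero smult_A)
    then show "Frobenius_hom 0 A B f"
      using 0 Phi1[OF f] by (auto simp: Frobenius_hom_def smult0 Pi_iff)
  qed
qed

text \<open>The existential over \<open>m\<close> encodes \<open>m = n - 1\<close> and thereby \<open>n \<ge> 1\<close>, without which the
  last condition would be meaningless.\<close>

definition transfer ::
  "nat \<Rightarrow> (complex, 'a, 'k) module_scheme \<Rightarrow> (complex, 'b, 'l) module_scheme \<Rightarrow>
   ('a \<Rightarrow> 'b) \<Rightarrow> ('b \<Rightarrow> 'a) \<Rightarrow> bool" where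
  "transfer n A B f \<tau> \<longleftrightarrow> f \<in> ring_hom A B \<and>
     Frobenius_hom n B A \<tau> \<and>
     (\<forall>a \<in> carrier A. \<forall>b \<in> carrier B. \<tau> (f a \<otimes>\<^bsub>B\<^esub> b) = a \<otimes>\<^bsub>A\<^esub> \<tau> b) \<and>
     (\<exists>m g. n = Suc m \<and> Frobenius_hom m B B g \<and>
        (\<forall>b \<in> carrier B. f (\<tau> b) = b \<oplus>\<^bsub>B\<^esub> g b))"

section \<open>Algebras of continuous functions\<close>

text \<open>A continuous function on \<open>X\<close> is represented by the extensional function (equal to
  \<^const>\<open>undefined\<close> outside the space) with the same values on \<^term>\<open>topspace X\<close>.\<close>

definition Cfun :: "'a topology \<Rightarrow> (complex, 'a \<Rightarrow> complex) module" where
  "Cfun X = \<lparr> carrier = {\<phi> \<in> extensional (topspace X). continuous_map X euclidean \<phi>},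
           mult = (\<lambda>\<phi> \<psi>. \<lambda>x \<in> topspace X. \<phi> x * \<psi> x),
           one = (\<lambda>x \<in> topspace X. 1),
           zero = (\<lambda>x \<in> topspace X. 0),
           add = (\<lambda>\<phi> \<psi>. \<lambda>x \<in> topspace X. \<phi> x + \<psi> x),
           module.smult = (\<lambda>c \<phi>. \<lambda>x \<in> topspace X. c * \<phi> x) \<rparr>"

lemma Cfun_simps [simp]:
  "\<phi> \<in> carrier (Cfun X) \<longleftrightarrow> \<phi> \<in> extensional (topspace X) \<and> continuous_map X euclidean \<phi>"
  "\<phi> \<otimes>\<^bsub>Cfun X\<^esub> \<psi> = (\<lambda>x \<in> topspace X. \<phi> x * \<psi> x)"
  "\<one>\<^bsub>Cfun X\<^esub> = (\<lambda>x \<in> topspace X. 1)"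
  "\<zero>\<^bsub>Cfun X\<^esub> = (\<lambda>x \<in> topspace X. 0)"
  "\<phi> \<oplus>\<^bsub>Cfun X\<^esub> \<psi> = (\<lambda>x \<in> topspace X. \<phi> x + \<psi> x)"
  "c \<odot>\<^bsub>Cfun X\<^esub> \<phi> = (\<lambda>x \<in> topspace X. c * \<phi> x)"
  by (simp_all add: Cfun_def)

lemma continuous_map_restrict_topspace:
  "continuous_map X Z (restrict \<phi> (topspace X)) \<longleftrightarrow> continuous_map X Z \<phi>"
  by (rule iffI; erule continuous_map_eq) auto

lemma algebra_Cfun: "Module.algebra complex_ring (Cfun X)"
proof -
  note [simp] = continuous_map_restrict_topspace continuous_map_add continuous_map_minus
  have mult: "continuous_map X euclidean (\<lambda>x. \<phi> x * \<psi> x)"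
    if "continuous_map X euclidean \<phi>" "continuous_map X euclidean \<psi>"
    for \<phi> \<psi> :: "'a \<Rightarrow> complex"
    using that unfolding continuous_map_atin limitin_canonical_iff by (auto intro: tendsto_mult)
  have eqI: "\<phi> = \<psi>" if "\<phi> \<in> extensional (topspace X)" "\<psi> \<in> extensional (topspace X)"
    "\<And>x. x \<in> topspace X \<Longrightarrow> \<phi> x = \<psi> x" for \<phi> \<psi> :: "'a \<Rightarrow> complex"
    using that by (rule extensionalityI)
  show ?thesis
  proof (rule Module.algebraI)
    show "cring complex_ring"
      by (rule cring_complex_ring)
    show "cring (Cfun X)"
    proof (rule cringI)
      show "abelian_group (Cfun X)"
      proof (rule abelian_groupI)
        fix \<phi> assume "\<phi> \<in> carrier (Cfun X)"
        then show "\<exists>\<psi> \<in> carrier (Cfun X). \<psi> \<oplus>\<^bsub>Cfun X\<^esub> \<phi> = \<zero>\<^bsub>Cfun X\<^esub>"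
          by (intro bexI[of _ "\<lambda>x \<in> topspace X. - \<phi> x"]) (auto intro!: eqI)
      qed (auto intro!: eqI simp: add_ac)
      show "comm_monoid (Cfun X)"
        by (rule comm_monoidI) (auto intro!: eqI mult simp: mult_ac)
    qed (auto intro!: eqI simp: distrib_right)
  qed (auto intro!: eqI mult simp: complex_ring_def distrib_right distrib_left)
qed

text \<open>The library metric on \<^const>\<open>cfunspace\<close> is the supremum of the pointwise distances, that is
  the metric of the supremum norm.\<close>

definition Cfun_top :: "'a topology \<Rightarrow> ('a \<Rightarrow> complex) topology" where
  "Cfun_top X = mtopology_of (cfunspace X euclidean_metric)"

lemma topspace_Cfun_top:
  assumes "compact_space X"
  shows "topspace (Cfun_top X) = carrier (Cfun X)"
  unfolding Cfun_top_def topspace_mtopology_of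
  using assms
  by (subst compactin_mspace_cfunspace) (simp_all add: compact_space_def set_eq_iff)

lemma mdist_Cfun_top:
  assumes "compact_space X" "topspace X \<noteq> {}" "\<phi> \<in> carrier (Cfun X)" "\<psi> \<in> carrier (Cfun X)"
  shows "mdist (cfunspace X euclidean_metric) \<phi> \<psi> = (SUP x \<in> topspace X. cmod (\<phi> x - \<psi> x))"
proof -
  have "\<phi> \<in> Met_TC.fspace (topspace X)" "\<psi> \<in> Met_TC.fspace (topspace X)"
    using assms(3,4) cfunspace_subset_funspace[of X euclidean_metric]
      topspace_Cfun_top[OF assms(1)] unfolding Cfun_top_def topspace_mtopology_of mspace_funspace
      mspace_euclidean_metric mdist_euclidean_metric
    by blast+
  then show ?thesis
    unfolding mdist_cfunspace_eq_mdist_funspace mdist_funspace mspace_euclidean_metric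
      mdist_euclidean_metric Met_TC.fdist_def
    using assms(2) by (simp add: dist_norm)
qed

definition pullback :: "'a topology \<Rightarrow> ('a \<Rightarrow> 'b) \<Rightarrow> ('b \<Rightarrow> complex) \<Rightarrow> 'a \<Rightarrow> complex" where
  "pullback X h \<psi> = (\<lambda>x \<in> topspace X. \<psi> (h x))"

lemma pullback_ring_hom:
  assumes "continuous_map X Y h"
  shows "pullback X h \<in> ring_hom (Cfun Y) (Cfun X)"
proof (rule ring_hom_memI)
  have h: "h x \<in> topspace Y" if "x \<in> topspace X" for x
    using assms that by (auto simp: continuous_map_def)
  show "pullback X h \<psi> \<in> carrier (Cfun X)" if "\<psi> \<in> carrier (Cfun Y)" for \<psi>
    using continuous_map_compose[OF assms, of euclidean \<psi>] that
    by (simp add: pullback_def continuous_map_restrict_topspace comp_def)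
  show "pullback X h (\<phi> \<otimes>\<^bsub>Cfun Y\<^esub> \<psi>) = pullback X h \<phi> \<otimes>\<^bsub>Cfun X\<^esub> pullback X h \<psi>" for \<phi> \<psi>
    by (auto simp: pullback_def h intro!: restrict_ext)
  show "pullback X h (\<phi> \<oplus>\<^bsub>Cfun Y\<^esub> \<psi>) = pullback X h \<phi> \<oplus>\<^bsub>Cfun X\<^esub> pullback X h \<psi>" for \<phi> \<psi>
    by (auto simp: pullback_def h intro!: restrict_ext)
  show "pullback X h \<one>\<^bsub>Cfun Y\<^esub> = \<one>\<^bsub>Cfun X\<^esub>"
    by (auto simp: pullback_def h intro!: restrict_ext)
qed

end

theory Submission
  imports Defs
begin

text \<open>Fix \<open>y \<in> Y\<close> and let \<open>L \<phi> = \<tau> \<phi> y\<close>, a continuous functional on \<open>C(X)\<close> with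
  \<open>L 1 = n\<close> and \<open>\<Phi>\<^sub>n\<^sub>+\<^sub>1(L) = 0\<close>. If the support of \<open>L\<close> contained \<open>n + 1\<close> points, there would be
  functions \<open>a\<^sub>0, \<dots>, a\<^sub>n\<close> with disjoint supports and \<open>L a\<^sub>i \<noteq> 0\<close>, while
  \<open>\<Phi>\<^sub>n\<^sub>+\<^sub>1(L)(a\<^sub>0, \<dots>, a\<^sub>n) = L a\<^sub>0 \<cdots> L a\<^sub>n\<close>. So the support is finite and, by continuity, \<open>L\<close> is a
  linear combination \<open>\<phi> \<mapsto> \<Sum>\<^sub>s c\<^sub>s \<phi>(s)\<close> over it. Applying \<open>\<Phi>\<^sub>n\<^sub>+\<^sub>1(L)\<close> to a function that is \<open>1\<close> at \<open>s\<close> and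
  \<open>0\<close> at the other support points gives \<open>c\<^sub>s(c\<^sub>s - 1)\<cdots>(c\<^sub>s - n) = 0\<close>, so \<open>c\<^sub>s\<close> is a natural number,
  and \<open>t(y)\<close> is the multiset in which \<open>s\<close> has multiplicity \<open>c\<^sub>s\<close>. The same argument for \<open>g\<close> at \<open>x\<close>
  shows \<open>t(h x) = [x] + N\<close> for a multiset \<open>N\<close>.\<close>

section \<open>Signed counts of cycles\<close>

text \<open>Applied after \<open>q\<close>, the transposition inserts \<open>n\<close> into the
  cycle through \<open>b\<close>, immediately before \<open>b\<close>: a path about to enter
  \<open>b\<close> visits \<open>n\<close> first. Deleting \<open>n\<close> recovers the old
  cycle.\<close>

lemma orbit_transpose_comp:
  fixes n :: nat
  assumes q: "q permutes {..<n}" and "b < n" and "x < n"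
  shows "orbit (Transposition.transpose n b \<circ> q) x - {n} = orbit q x"
proof -
  define s where "s = Transposition.transpose n b \<circ> q"
  have q_less: "q y < n" if "y < n" for y
    using permutes_in_image[OF q, of y] that by simp
  have "q n = n" by (simp add: permutes_not_in[OF q])
  then have s_n: "s n = b" by (simp add: s_def)
  have s_less: "s y = (if q y = b then n else q y)" if "y < n" for y
    using q_less[OF that] by (auto simp: s_def Transposition.transpose_def)
  \<comment> \<open>Induction along the new cycle with \<open>n\<close> read as \<open>b\<close>:
    the detour through \<open>n\<close> begins where \<open>q\<close> would reach \<open>b\<close>
    and ends in \<open>b\<close>.\<close>
  have sub1: "(if y = n then b else y) \<in> orbit q x \<and> y \<le> n" if "y \<in> orbit s x" for y
    using that
  proof induction
    case base
    show ?case using \<open>b < n\<close> \<open>x < n\<close> q_less[of x] orbit.base[of q x] by (auto simp: s_less)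
  next
    case (step y)
    show ?case
    proof (cases "y = n")
      case True
      then show ?thesis using step s_n \<open>b < n\<close> by auto
    next
      case False
      then have "y < n" and "q y \<in> orbit q x"
        using step by (auto intro: orbit.step)
      then show ?thesis using q_less[of y] s_less[of y] by auto
    qed
  qed
  have sub2: "y < n \<and> y \<in> orbit s x" if "y \<in> orbit q x" for y
  proof -
    have q_step: "q y \<in> orbit s x" if "y < n" "s y \<in> orbit s x" for y
      using that s_less[of y] s_n orbit.step[of n s x] by (auto split: if_splits)
    show ?thesis
      using that
    proof induction
      case base
      show ?case using q_step[OF \<open>x < n\<close> orbit.base] q_less[OF \<open>x < n\<close>] by simp
    next
      case (step y)
      then show ?case using q_step[of y] q_less[of y] by (auto intro: orbit.step)
    qed
  qed
  have "orbit s x - {n} = orbit q x"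
  proof (intro equalityI subsetI)
    fix y assume "y \<in> orbit s x - {n}"
    then show "y \<in> orbit q x" using sub1[of y] by simp
  next
    fix y assume "y \<in> orbit q x"
    then show "y \<in> orbit s x - {n}" using sub2[of y] by simp
  qed
  then show ?thesis by (simp only: s_def)
qed

lemma permutes_self_in_orbit:
  assumes "p permutes S" "finite S"
  shows "x \<in> orbit p x"
  using assms permutation_permutes permutation_self_in_orbit by metis

text \<open>Here \<open>n\<close> joins an existing cycle, so no cycle is created: deleting
  \<open>n\<close> maps the new cycles bijectively onto the old ones. Injectivity holds because
  every new cycle contains some \<open>x < n\<close>, which survives the deletion.\<close>

lemma card_orbits_transpose_comp:
  fixes n :: nat
  assumes q: "q permutes {..<n}" and b: "b < n"
  shows "card (orbit (Transposition.transpose n b \<circ> q) ` {..<Suc n}) = card (orbit q ` {..<n})"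
proof -
  let ?s = "Transposition.transpose n b \<circ> q"
  have "?s permutes {..<Suc n}"
    using q b by (intro permutes_compose[OF permutes_subset] permutes_swap_id) auto
  then have s: "permutation ?s" by (auto simp: permutation_permutes)
  have mem: "orbit ?s y = orbit ?s x" if "y \<in> orbit ?s x" for x y
    using orbit_cyclic_eq3[OF cyclic_on_orbit'[OF s] that] .
  have "?s n = b" by (simp add: permutes_not_in[OF q])
  then have "orbit ?s n = orbit ?s b"
    using mem[of b n] orbit.base[of ?s n] by simp
  then have "orbit ?s ` {..<Suc n} = orbit ?s ` {..<n}"
    using b by (auto simp: lessThan_Suc)
  moreover have "inj_on (\<lambda>A. A - {n}) (orbit ?s ` {..<n})"
  proof (rule inj_onI)
    fix A B assume "A \<in> orbit ?s ` {..<n}" "B \<in> orbit ?s ` {..<n}" and eq: "A - {n} = B - {n}"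
    then obtain x y where "A = orbit ?s x" "B = orbit ?s y" "x < n" by auto
    moreover from this have "x \<in> orbit ?s y"
      using permutation_self_in_orbit[OF s, of x] eq by auto
    ultimately show "A = B" using mem by simp
  qed
  ultimately have "card (orbit ?s ` {..<Suc n}) = card ((\<lambda>A. A - {n}) ` orbit ?s ` {..<n})"
    by (simp add: card_image)
  also have "(\<lambda>A. A - {n}) ` orbit ?s ` {..<n} = orbit q ` {..<n}"
    unfolding image_image using orbit_transpose_comp[OF q b] by (intro image_cong) auto
  finally show ?thesis .
qed

lemma card_orbits_Suc:
  assumes q: "q permutes {..<n}"
  shows "card (orbit q ` {..<Suc n}) = Suc (card (orbit q ` {..<n}))"
proof -
  have "orbit q n = {n}"
    by (simp add: orbit_eq_singleton_iff permutes_not_in[OF q])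
  moreover have "{n} \<notin> orbit q ` {..<n}"
    using permutes_self_in_orbit[OF q] by force
  ultimately show ?thesis by (simp add: lessThan_Suc)
qed

text \<open>The generating function of the signed Stirling numbers of the first kind. It will turn
  \<open>\<Phi>\<close> at equal arguments into a polynomial in one number. The induction writes
  each permutation of \<open>{..<Suc n}\<close> uniquely as a permutation \<open>q\<close> of
  \<open>{..<n}\<close> followed by the transposition of \<open>n\<close> with some
  \<open>b \<le> n\<close>.\<close>

lemma sum_sign_power_card_orbits:
  fixes z :: "'a::comm_ring_1"
  shows "(\<Sum>\<sigma> | \<sigma> permutes {..<n}. of_int (sign \<sigma>) * z ^ card (orbit \<sigma> ` {..<n}))
    = (\<Prod>i<n. z - of_nat i)"
proof (induction n)
  case 0
  then show ?case by (simp add: sign_id)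
next
  case (Suc n)
  let ?F = "\<lambda>m \<sigma>. of_int (sign \<sigma>) * z ^ card (orbit \<sigma> ` {..<m})"
  \<comment> \<open>The choice \<open>b = n\<close> adds the fixed point \<open>n\<close> and hence
    a factor \<open>z\<close>; each of the \<open>n\<close> choices \<open>b < n\<close> flips the
    sign and keeps the number of cycles. Together they give the factor \<open>z - n\<close>.\<close>
  have F_Suc: "?F (Suc n) (Transposition.transpose n b \<circ> q) = (if b = n then z else - 1) * ?F n q"
    if q: "q permutes {..<n}" and b: "b \<le> n" for q b
  proof (cases "b = n")
    case True
    then show ?thesis using card_orbits_Suc[OF q] by simp
  next
    case False
    have "permutation q" using q by (auto simp: permutation_permutes)
    then have "sign (Transposition.transpose n b \<circ> q) = - sign q"
      using False by (simp add: sign_compose sign_swap_id permutation_swap_id)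
    then show ?thesis using False b card_orbits_transpose_comp[OF q, of b] by simp
  qed
  have "(\<Sum>\<sigma> | \<sigma> permutes {..<Suc n}. ?F (Suc n) \<sigma>) =
    (\<Sum>b\<in>insert n {..<n}. \<Sum>q | q permutes {..<n}. ?F (Suc n) (Transposition.transpose n b \<circ> q))"
    using sum_over_permutations_insert[of "{..<n}" n "?F (Suc n)"] by (simp add: lessThan_Suc)
  also have "\<dots> = (\<Sum>b\<in>insert n {..<n}. \<Sum>q | q permutes {..<n}. (if b = n then z else - 1) * ?F n q)"
    by (intro sum.cong refl F_Suc) auto
  also have "\<dots> = (\<Sum>b\<in>insert n {..<n}. if b = n then z else - 1) * (\<Prod>i<n. z - of_nat i)"
    by (simp only: Suc.IH sum_distrib_right flip: sum_distrib_left)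
  also have "(\<Sum>b\<in>insert n {..<n}. if b = n then z else - 1) = z - of_nat n"
    by (subst sum.insert) (auto simp: sum.If_cases)
  finally show ?case by (simp add: mult.commute)
qed

section \<open>Pointwise evaluation in algebras of continuous functions\<close>

lemma Cfun_cring: "cring (Cfun X)"
  using algebra.M_cring[OF algebra_Cfun] .

lemma continuous_map_complex_mult:
  fixes f g :: "'a \<Rightarrow> complex"
  assumes "continuous_map X euclidean f" "continuous_map X euclidean g"
  shows "continuous_map X euclidean (\<lambda>x. f x * g x)"
  using assms unfolding continuous_map_atin limitin_canonical_iff by (auto intro: tendsto_mult)

lemma continuous_map_complex_prod:
  fixes f :: "'i \<Rightarrow> 'a \<Rightarrow> complex"
  assumes "\<And>i. i \<in> I \<Longrightarrow> continuous_map X euclidean (f i)"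
  shows "continuous_map X euclidean (\<lambda>x. \<Prod>i\<in>I. f i x)"
  using assms unfolding continuous_map_atin limitin_canonical_iff by (auto intro: tendsto_prod)

lemma finprod_Cfun:
  assumes "finite I" "\<And>i. i \<in> I \<Longrightarrow> a i \<in> carrier (Cfun X)"
  shows "finprod (Cfun X) a I = (\<lambda>x\<in>topspace X. \<Prod>i\<in>I. a i x)"
  using assms
proof (induction I)
  case empty
  interpret cring "Cfun X" by (rule Cfun_cring)
  show ?case by (simp flip: Cfun_simps)
next
  case (insert i I)
  interpret cring "Cfun X" by (rule Cfun_cring)
  have "finprod (Cfun X) a (insert i I) = a i \<otimes>\<^bsub>Cfun X\<^esub> finprod (Cfun X) a I"
    using insert by (intro finprod_insert) blast+
  then show ?case using insert by (auto intro!: restrict_ext)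
qed

lemma finsum_Cfun:
  assumes "finite I" "\<And>i. i \<in> I \<Longrightarrow> a i \<in> carrier (Cfun X)"
  shows "finsum (Cfun X) a I = (\<lambda>x\<in>topspace X. \<Sum>i\<in>I. a i x)"
  using assms
proof (induction I)
  case empty
  interpret cring "Cfun X" by (rule Cfun_cring)
  show ?case by (simp flip: Cfun_simps)
next
  case (insert i I)
  interpret cring "Cfun X" by (rule Cfun_cring)
  have "finsum (Cfun X) a (insert i I) = a i \<oplus>\<^bsub>Cfun X\<^esub> finsum (Cfun X) a I"
    using insert by (intro finsum_insert) blast+
  then show ?case using insert by (auto intro!: restrict_ext)
qed

text \<open>The operations of \<open>Cfun Y\<close> are pointwise, so at \<open>y\<close> the
  element \<open>\<Phi>\<close> becomes a scalar expression in the functional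
  \<open>\<phi> \<mapsto> f \<phi> y\<close>. This reduces Frobenius homomorphisms to complex-valued
  functionals.\<close>

lemma Frobenius_Phi_Cfun:
  assumes f: "f \<in> carrier (Cfun X) \<rightarrow> carrier (Cfun Y)"
    and a: "\<And>i. i < n \<Longrightarrow> a i \<in> carrier (Cfun X)"
    and y: "y \<in> topspace Y"
  shows "Frobenius_Phi (Cfun X) (Cfun Y) n f a y =
    (\<Sum>\<sigma> | \<sigma> permutes {..<n}. of_int (sign \<sigma>) *
       (\<Prod>\<gamma>\<in>orbit \<sigma> ` {..<n}. f (\<lambda>x\<in>topspace X. \<Prod>i\<in>\<gamma>. a i x) y))"
proof -
  let ?p = "\<lambda>\<gamma>. \<lambda>x\<in>topspace X. \<Prod>i\<in>\<gamma>. a i x"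
  interpret CY: Module.algebra complex_ring "Cfun Y" by (rule algebra_Cfun)
  have sub: "\<gamma> \<subseteq> {..<n}" if "\<sigma> permutes {..<n}" "\<gamma> \<in> orbit \<sigma> ` {..<n}" for \<sigma> \<gamma>
    using that permutes_orbit_subset by fastforce
  have p: "?p \<gamma> \<in> carrier (Cfun X)" if "\<gamma> \<subseteq> {..<n}" for \<gamma>
    using that a by (auto simp: continuous_map_restrict_topspace intro!: continuous_map_complex_prod)
  have fp: "f (?p \<gamma>) \<in> carrier (Cfun Y)" if "\<gamma> \<subseteq> {..<n}" for \<gamma>
    using p[OF that] f by blast
  have inner: "finprod (Cfun Y) (\<lambda>\<gamma>. f (finprod (Cfun X) a \<gamma>)) (orbit \<sigma> ` {..<n})
      = (\<lambda>y\<in>topspace Y. \<Prod>\<gamma>\<in>orbit \<sigma> ` {..<n}. f (?p \<gamma>) y)" if \<sigma>: "\<sigma> permutes {..<n}" for \<sigma>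
  proof -
    have eq: "finprod (Cfun X) a \<gamma> = ?p \<gamma>" if "\<gamma> \<in> orbit \<sigma> ` {..<n}" for \<gamma>
      using sub[OF \<sigma> that] a by (intro finprod_Cfun) (auto intro: finite_subset)
    then have "finprod (Cfun Y) (\<lambda>\<gamma>. f (finprod (Cfun X) a \<gamma>)) (orbit \<sigma> ` {..<n})
      = (\<lambda>y\<in>topspace Y. \<Prod>\<gamma>\<in>orbit \<sigma> ` {..<n}. f (finprod (Cfun X) a \<gamma>) y)"
      using fp sub[OF \<sigma>] by (intro finprod_Cfun) auto
    then show ?thesis using eq by (auto intro!: restrict_ext prod.cong)
  qed
  have cont: "continuous_map Y euclidean (\<lambda>y. \<Prod>\<gamma>\<in>orbit \<sigma> ` {..<n}. f (?p \<gamma>) y)"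
    if \<sigma>: "\<sigma> permutes {..<n}" for \<sigma>
    using fp sub[OF \<sigma>] by (intro continuous_map_complex_prod) auto
  have "Frobenius_Phi (Cfun X) (Cfun Y) n f a = (\<lambda>y\<in>topspace Y. \<Sum>\<sigma> | \<sigma> permutes {..<n}.
      (complex_of_int (sign \<sigma>) \<odot>\<^bsub>Cfun Y\<^esub> finprod (Cfun Y) (\<lambda>\<gamma>. f (finprod (Cfun X) a \<gamma>)) (orbit \<sigma> ` {..<n})) y)"
    unfolding Frobenius_Phi_def
  proof (rule finsum_Cfun)
    show "finite {\<sigma>. \<sigma> permutes {..<n}}" by (simp add: finite_permutations)
  next
    fix \<sigma> assume "\<sigma> \<in> {\<sigma>. \<sigma> permutes {..<n}}"
    then show "complex_of_int (sign \<sigma>) \<odot>\<^bsub>Cfun Y\<^esub> finprod (Cfun Y) (\<lambda>\<gamma>. f (finprod (Cfun X) a \<gamma>)) (orbit \<sigma> ` {..<n}) \<in> carrier (Cfun Y)"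
      using CY.smult_closed[of "complex_of_int (sign \<sigma>)"
          "\<lambda>y\<in>topspace Y. \<Prod>\<gamma>\<in>orbit \<sigma> ` {..<n}. f (?p \<gamma>) y"] inner[of \<sigma>] cont[of \<sigma>]
      by (simp add: continuous_map_restrict_topspace complex_ring_def del: Cfun_simps(6))
  qed
  then show ?thesis using y by (simp add: inner)
qed

section \<open>Urysohn functions and separation of finitely many points\<close>

lemma bump_function:
  assumes "compact_space X" "Hausdorff_space X" "openin X U" "p \<in> U"
  obtains u :: "'a \<Rightarrow> real" where "continuous_map X euclideanreal u" "u p = 1"
    "\<And>x. x \<in> topspace X \<Longrightarrow> 0 \<le> u x" "\<And>x. x \<in> topspace X - U \<Longrightarrow> u x = 0"
proof -
  \<comment> \<open>Normality makes Urysohn's lemma available. The lower bound 0 later keeps sums of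
    bump functions free of cancellation.\<close>
  have "normal_space X"
    using assms by (simp add: compact_Hausdorff_or_regular_imp_normal_space)
  moreover have "p \<in> topspace X"
    using assms openin_subset by blast
  then have "closedin X {p}"
    using assms by (simp add: closedin_Hausdorff_sing_eq)
  moreover have "closedin X (topspace X - U)"
    using assms by blast
  ultimately obtain u where "continuous_map X (top_of_set {0..1::real}) u"
    "u ` (topspace X - U) \<subseteq> {0}" "u ` {p} \<subseteq> {1}"
    using Urysohn_lemma[of X "topspace X - U" "{p}" 0 1] assms(4) by (auto simp: disjnt_def)
  note u = this
  then have "continuous_map X euclideanreal u" and range: "u ` topspace X \<subseteq> {0..1}"
    by (simp_all add: continuous_map_in_subtopology image_subset_iff_funcset)
  then show thesis
  proof (intro that[of u])
    show "u p = 1" using u(3) by blast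
    show "0 \<le> u x" if "x \<in> topspace X" for x
      using range that by (meson atLeastAtMost_iff image_subset_iff)
    show "u x = 0" if "x \<in> topspace X - U" for x
      using u(2) that by blast
  qed
qed

lemma continuous_map_complex_of_real:
  "continuous_map X euclideanreal u \<Longrightarrow> continuous_map X euclidean (\<lambda>x. complex_of_real (u x))"
  unfolding continuous_map_atin limitin_canonical_iff by (auto intro: tendsto_of_real)

lemma separating_function:
  assumes "compact_space X" "Hausdorff_space X" "finite F" "F \<subseteq> topspace X" "p \<in> topspace X - F"
  shows "\<exists>\<phi> :: 'a \<Rightarrow> complex. continuous_map X euclidean \<phi> \<and> \<phi> p = 1 \<and> (\<forall>x\<in>F. \<phi> x = 0)"
proof -
  have "openin X (topspace X - F)"
    using closedin_Hausdorff_finite[OF assms(2,4,3)] by blast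
  then obtain u :: "'a \<Rightarrow> real" where u: "continuous_map X euclideanreal u" "u p = 1"
    "\<And>x. x \<in> topspace X - (topspace X - F) \<Longrightarrow> u x = 0"
    using bump_function[OF assms(1,2) _ assms(5)] by metis
  show ?thesis
  proof (intro exI conjI ballI)
    show "continuous_map X euclidean (\<lambda>x. complex_of_real (u x))"
      using u(1) by (rule continuous_map_complex_of_real)
    show "complex_of_real (u p) = 1" using u(2) by simp
    show "complex_of_real (u x) = 0" if "x \<in> F" for x
      using u(3)[of x] that assms(4) by auto
  qed
qed

lemma Hausdorff_space_disjoint_neighbourhoods:
  assumes "Hausdorff_space X" "finite T" "T \<subseteq> topspace X"
  obtains W where "\<And>s. s \<in> T \<Longrightarrow> openin X (W s) \<and> s \<in> W s"
    "\<And>s t. s \<in> T \<Longrightarrow> t \<in> T \<Longrightarrow> s \<noteq> t \<Longrightarrow> W s \<inter> W t = {}"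
proof -
  let ?sep = "\<lambda>s t P. openin X (fst P) \<and> openin X (snd P) \<and> s \<in> fst P \<and> t \<in> snd P \<and> fst P \<inter> snd P = {}"
  have "\<exists>P. ?sep s t P" if st: "s \<in> T" "t \<in> T - {s}" for s t
  proof -
    obtain A B where "openin X A" "openin X B" "s \<in> A" "t \<in> B" "disjnt A B"
      using assms(1,3) st unfolding Hausdorff_space_def by (metis DiffE singletonI subsetD)
    then show ?thesis by (intro exI[of _ "(A, B)"]) (simp add: disjnt_def)
  qed
  note sep = someI_ex[OF this]
  define U where "U s t = fst (SOME P. ?sep s t P)" for s t
  define V where "V s t = snd (SOME P. ?sep s t P)" for s t
  have UV: "openin X (U s t) \<and> openin X (V s t) \<and> s \<in> U s t \<and> t \<in> V s t \<and> U s t \<inter> V s t = {}"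
    if "s \<in> T" "t \<in> T - {s}" for s t
    using sep[OF that] unfolding U_def V_def .
  \<comment> \<open>The pairs chosen for \<open>(s, t)\<close> and \<open>(t, s)\<close> are
    unrelated, so \<open>W s\<close> is cut down by the member containing \<open>s\<close> of each.
    Intersecting with \<open>topspace X\<close> handles the case of an empty index set.\<close>
  define W where "W s = (\<Inter>t\<in>T - {s}. U s t \<inter> V t s) \<inter> topspace X" for s
  have "openin X (W s) \<and> s \<in> W s" if "s \<in> T" for s
  proof -
    have "openin X (W s)"
      unfolding W_def
    proof (rule openin_INT)
      show "finite (T - {s})" using assms by blast
      show "openin X (U s t \<inter> V t s)" if "t \<in> T - {s}" for t
        using UV[of s t] UV[of t s] that \<open>s \<in> T\<close> by blast
    qed
    moreover have "s \<in> W s"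
      using that UV assms unfolding W_def by blast
    ultimately show ?thesis ..
  qed
  moreover have "W s \<inter> W t = {}" if "s \<in> T" "t \<in> T" "s \<noteq> t" for s t
    using UV[of s t] that unfolding W_def by blast
  ultimately show thesis by (rule that)
qed

section \<open>Frobenius functionals\<close>

text \<open>A continuous Frobenius \<open>n\<close>-homomorphism from \<open>C(X)\<close> to the
  complex numbers. \<open>L\<close> accepts arbitrary functions and \<open>cong\<close> makes only
  their values on the space count, so lambda terms need no restriction; \<open>small\<close> is
  continuity at zero. Instances are \<open>\<tau>\<close> evaluated at a point of \<open>Y\<close>
  and \<open>g\<close> evaluated at a point of \<open>X\<close>.\<close>

locale Frobenius_functional =
  fixes X :: "'a topology" and n :: nat and L :: "('a \<Rightarrow> complex) \<Rightarrow> complex"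
  assumes compact: "compact_space X" and Hausdorff: "Hausdorff_space X"
    and cong: "(\<And>x. x \<in> topspace X \<Longrightarrow> \<phi> x = \<psi> x) \<Longrightarrow> L \<phi> = L \<psi>"
    and add: "continuous_map X euclidean \<phi> \<Longrightarrow> continuous_map X euclidean \<psi> \<Longrightarrow>
      L (\<lambda>x. \<phi> x + \<psi> x) = L \<phi> + L \<psi>"
    and scale: "continuous_map X euclidean \<phi> \<Longrightarrow> L (\<lambda>x. c * \<phi> x) = c * L \<phi>"
    and small: "\<epsilon> > 0 \<Longrightarrow> \<exists>\<delta>>0. \<forall>\<phi>. continuous_map X euclidean \<phi> \<longrightarrow>
      (\<forall>x\<in>topspace X. cmod (\<phi> x) \<le> \<delta>) \<longrightarrow> cmod (L \<phi>) < \<epsilon>"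
    and one: "L (\<lambda>_. 1) = of_nat n"
    and Frobenius: "(\<And>i. i \<le> n \<Longrightarrow> continuous_map X euclidean (a i)) \<Longrightarrow>
      (\<Sum>\<sigma> | \<sigma> permutes {..<Suc n}. of_int (sign \<sigma>) *
         (\<Prod>\<gamma>\<in>orbit \<sigma> ` {..<Suc n}. L (\<lambda>x. \<Prod>i\<in>\<gamma>. a i x))) = 0"
begin

text \<open>The support of \<open>L\<close> regarded as a complex measure on
  \<open>X\<close>.\<close>

definition support :: "'a set" where
  "support = {s \<in> topspace X. \<forall>U. openin X U \<longrightarrow> s \<in> U \<longrightarrow>
     (\<exists>\<phi>. continuous_map X euclidean \<phi> \<and> (\<forall>x\<in>topspace X - U. \<phi> x = 0) \<and> L \<phi> \<noteq> 0)}"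

lemma zero: "(\<And>x. x \<in> topspace X \<Longrightarrow> \<phi> x = 0) \<Longrightarrow> L \<phi> = 0"
  using scale[of "\<lambda>_. 0" 0] cong[of \<phi> "\<lambda>_. 0"] by simp

lemma sum:
  assumes "finite I" "\<And>i. i \<in> I \<Longrightarrow> continuous_map X euclidean (\<phi> i)"
  shows "L (\<lambda>x. \<Sum>i\<in>I. \<phi> i x) = (\<Sum>i\<in>I. L (\<phi> i))"
  using assms
proof (induction I)
  case empty
  then show ?case using zero by simp
next
  case (insert i I)
  then show ?case
    using add[of "\<phi> i" "\<lambda>x. \<Sum>i\<in>I. \<phi> i x"] by (simp add: continuous_map_sum)
qed

text \<open>For functions with pairwise disjoint supports, every term of \<open>\<Phi>\<close> that comes from a
  permutation other than the identity contains a factor \<open>L 0\<close>.\<close>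

lemma prod_orthogonal_eq_0:
  assumes cont: "\<And>i. i \<le> n \<Longrightarrow> continuous_map X euclidean (a i)"
    and orth: "\<And>i j x. i \<le> n \<Longrightarrow> j \<le> n \<Longrightarrow> i \<noteq> j \<Longrightarrow> x \<in> topspace X \<Longrightarrow> a i x * a j x = 0"
  shows "(\<Prod>i\<le>n. L (a i)) = 0"
proof -
  let ?F = "\<lambda>\<sigma>. of_int (sign \<sigma>) * (\<Prod>\<gamma>\<in>orbit \<sigma> ` {..<Suc n}. L (\<lambda>x. \<Prod>i\<in>\<gamma>. a i x))"
  have zero_term: "?F \<sigma> = 0" if \<sigma>: "\<sigma> permutes {..<Suc n}" and "\<sigma> \<noteq> id" for \<sigma>
  proof -
    obtain i where i: "\<sigma> i \<noteq> i" using \<open>\<sigma> \<noteq> id\<close> by (auto simp: fun_eq_iff)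
    then have "i < Suc n" using permutes_not_in[OF \<sigma>, of i] by auto
    then have "\<sigma> i < Suc n" using permutes_in_image[OF \<sigma>, of i] by simp
    have sub: "orbit \<sigma> i \<subseteq> {..<Suc n}"
      using permutes_orbit_subset[OF \<sigma>] \<open>i < Suc n\<close> by simp
    \<comment> \<open>A moved index \<open>i\<close> shares its cycle with the different index
      \<open>\<sigma> i\<close>, and at each point one of the two functions vanishes.\<close>
    have "L (\<lambda>x. \<Prod>j\<in>orbit \<sigma> i. a j x) = 0"
    proof (rule zero)
      fix x assume x: "x \<in> topspace X"
      have "i \<in> orbit \<sigma> i" "\<sigma> i \<in> orbit \<sigma> i"
        using permutes_self_in_orbit[OF \<sigma>] orbit.base[of \<sigma> i] by auto
      moreover have "a i x = 0 \<or> a (\<sigma> i) x = 0"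
        using orth[OF _ _ i[symmetric] x] \<open>i < Suc n\<close> \<open>\<sigma> i < Suc n\<close> by simp
      ultimately show "(\<Prod>j\<in>orbit \<sigma> i. a j x) = 0"
        using finite_subset[OF sub] by (auto simp: prod_zero_iff)
    qed
    then have "(\<Prod>\<gamma>\<in>orbit \<sigma> ` {..<Suc n}. L (\<lambda>x. \<Prod>i\<in>\<gamma>. a i x)) = 0"
      using \<open>i < Suc n\<close> by (intro prod_zero) auto
    then show ?thesis by simp
  qed
  have "0 = (\<Sum>\<sigma> | \<sigma> permutes {..<Suc n}. ?F \<sigma>)"
    using Frobenius cont by simp
  also have "\<dots> = ?F id"
    using sum.remove[of "{\<sigma>. \<sigma> permutes {..<Suc n}}" id ?F]
      sum.neutral[of "{\<sigma>. \<sigma> permutes {..<Suc n}} - {id}" ?F] zero_term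
    by (simp add: finite_permutations permutes_id del: of_int_mult)
  also have "orbit id ` {..<Suc n} = (\<lambda>i. {i}) ` {..<Suc n}"
    by (intro image_cong) (auto simp: orbit_eq_singleton_iff)
  also have "of_int (sign (id :: nat \<Rightarrow> nat)) * (\<Prod>\<gamma>\<in>(\<lambda>i. {i}) ` {..<Suc n}. L (\<lambda>x. \<Prod>i\<in>\<gamma>. a i x))
      = (\<Prod>i<Suc n. L (a i))"
    by (subst prod.reindex) (auto simp: sign_id)
  finally show ?thesis by (simp add: lessThan_Suc_atMost)
qed

lemma finite_support: "finite support"
proof (rule ccontr)
  assume "infinite support"
  then obtain T where T: "T \<subseteq> support" "finite T" "card T = Suc n"
    using infinite_arbitrarily_large by blast
  have "T \<subseteq> topspace X" using T by (auto simp: support_def)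
  then obtain W where W: "\<And>s. s \<in> T \<Longrightarrow> openin X (W s) \<and> s \<in> W s"
    "\<And>s t. s \<in> T \<Longrightarrow> t \<in> T \<Longrightarrow> s \<noteq> t \<Longrightarrow> W s \<inter> W t = {}"
    using Hausdorff_space_disjoint_neighbourhoods[OF Hausdorff T(2)] by blast
  have "\<forall>s\<in>T. \<exists>\<phi>. continuous_map X euclidean \<phi> \<and> (\<forall>x\<in>topspace X - W s. \<phi> x = 0) \<and> L \<phi> \<noteq> 0"
    using W(1) T(1) unfolding support_def by blast
  then obtain \<phi> where \<phi>: "\<And>s. s \<in> T \<Longrightarrow> continuous_map X euclidean (\<phi> s)"
    "\<And>s x. s \<in> T \<Longrightarrow> x \<in> topspace X - W s \<Longrightarrow> \<phi> s x = 0" "\<And>s. s \<in> T \<Longrightarrow> L (\<phi> s) \<noteq> 0"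
    by metis
  \<comment> \<open>The \<open>n + 1\<close> points of \<open>T\<close> are numbered
    \<open>0, ..., n\<close>, the index range of \<open>prod_orthogonal_eq_0\<close>.\<close>
  obtain e where e: "bij_betw e {..n} T"
    using T finite_same_card_bij[of "{..n}" T] by auto
  then have eT: "e i \<in> T" if "i \<le> n" for i
    using that by (auto simp: bij_betw_def)
  have "(\<Prod>i\<le>n. L (\<phi> (e i))) = 0"
  proof (rule prod_orthogonal_eq_0)
    fix i j x assume *: "i \<le> n" "j \<le> n" "i \<noteq> j" "x \<in> topspace X"
    then have "e i \<noteq> e j" using e by (auto simp: bij_betw_def inj_on_def)
    then have "x \<notin> W (e i) \<or> x \<notin> W (e j)"
      using W(2)[of "e i" "e j"] eT * by blast
    then show "\<phi> (e i) x * \<phi> (e j) x = 0"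
      using \<phi>(2) eT * by auto
  qed (use \<phi> eT in auto)
  then show False using \<phi>(3) eT by auto
qed

text \<open>The set where \<open>\<phi>\<close> is not small is compact and misses the support, so
  finitely many bump functions whose multiples \<open>L\<close> annihilates cover it. They yield
  \<open>?w\<close> with \<open>L ?w = 0\<close> that is uniformly close to \<open>\<phi>\<close>,
  and continuity of \<open>L\<close> at zero applies to the difference.\<close>

lemma eq_0_if_zero_on_support:
  assumes \<phi>: "continuous_map X euclidean \<phi>" and \<phi>0: "\<And>s. s \<in> support \<Longrightarrow> \<phi> s = 0"
  shows "L \<phi> = 0"
proof (rule ccontr)
  assume "L \<phi> \<noteq> 0"
  \<comment> \<open>The tolerance is \<open>cmod (L \<phi>)\<close> itself, so that the
    contradiction will read \<open>cmod (L \<phi>) < cmod (L \<phi>)\<close>.\<close>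
  then obtain \<delta> where "\<delta> > 0" and \<delta>: "\<And>\<psi>. continuous_map X euclidean \<psi> \<Longrightarrow>
      (\<forall>x\<in>topspace X. cmod (\<psi> x) \<le> \<delta>) \<Longrightarrow> cmod (L \<psi>) < cmod (L \<phi>)"
    using small[of "cmod (L \<phi>)"] by auto
  have norm\<phi>: "continuous_map X euclideanreal (\<lambda>x. cmod (\<phi> x))"
    using \<phi> by (intro continuous_map_norm)
  define K where "K = {x \<in> topspace X. cmod (\<phi> x) \<in> {\<delta>..}}"
  have "closedin X K"
    unfolding K_def using norm\<phi> by (rule closedin_continuous_map_preimage) simp
  then have K: "compactin X K"
    using compact by (simp add: closedin_compact_space)
  \<comment> \<open>A point outside the support has a neighbourhood \<open>U\<close> such that
    \<open>L\<close> kills all functions vanishing off \<open>U\<close>; a bump function for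
    \<open>U\<close> passes this property to all its multiples.\<close>
  have "\<forall>p\<in>K. \<exists>u. continuous_map X euclideanreal u \<and> u p = 1 \<and> (\<forall>x\<in>topspace X. 0 \<le> u x)
    \<and> (\<forall>\<psi>. continuous_map X euclidean \<psi> \<longrightarrow> L (\<lambda>x. complex_of_real (u x) * \<psi> x) = 0)"
  proof
    fix p assume "p \<in> K"
    then have "p \<in> topspace X" "p \<notin> support"
      using \<phi>0[of p] \<open>\<delta> > 0\<close> by (auto simp: K_def)
    then obtain U where U: "openin X U" "p \<in> U" "\<And>\<psi>. continuous_map X euclidean \<psi> \<Longrightarrow>
        (\<forall>x\<in>topspace X - U. \<psi> x = 0) \<Longrightarrow> L \<psi> = 0"
      unfolding support_def by blast
    obtain u :: "'a \<Rightarrow> real" where u: "continuous_map X euclideanreal u" "u p = 1"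
      "\<And>x. x \<in> topspace X \<Longrightarrow> 0 \<le> u x" "\<And>x. x \<in> topspace X - U \<Longrightarrow> u x = 0"
      using bump_function[OF compact Hausdorff U(1,2)] by blast
    have "L (\<lambda>x. complex_of_real (u x) * \<psi> x) = 0" if "continuous_map X euclidean \<psi>" for \<psi>
      using u that by (intro U(3) continuous_map_complex_mult continuous_map_complex_of_real) auto
    then show "\<exists>u. continuous_map X euclideanreal u \<and> u p = 1 \<and> (\<forall>x\<in>topspace X. 0 \<le> u x)
        \<and> (\<forall>\<psi>. continuous_map X euclidean \<psi> \<longrightarrow> L (\<lambda>x. complex_of_real (u x) * \<psi> x) = 0)"
      using u by blast
  qed
  from bchoice[OF this] obtain u where u: "\<And>p. p \<in> K \<Longrightarrow> continuous_map X euclideanreal (u p)"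
    "\<And>p. p \<in> K \<Longrightarrow> u p p = 1" "\<And>p x. p \<in> K \<Longrightarrow> x \<in> topspace X \<Longrightarrow> 0 \<le> u p x"
    "\<And>p \<psi>. p \<in> K \<Longrightarrow> continuous_map X euclidean \<psi> \<Longrightarrow>
      L (\<lambda>x. complex_of_real (u p x) * \<psi> x) = 0"
    by blast
  \<comment> \<open>At the level \<open>1/2\<close> these sets are open and cover \<open>K\<close>,
    and a finite subcover forces the sum \<open>v\<close> to be at least \<open>1/2\<close> on
    \<open>K\<close>.\<close>
  let ?V = "\<lambda>p. {x \<in> topspace X. u p x \<in> {1/2<..}}"
  have "\<exists>\<F>. finite \<F> \<and> \<F> \<subseteq> ?V ` K \<and> K \<subseteq> \<Union>\<F>"
  proof (rule compactinD[OF K])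
    fix V assume "V \<in> ?V ` K"
    then obtain p where "p \<in> K" "V = ?V p" by blast
    then show "openin X V"
      using openin_continuous_map_preimage[OF u(1)[of p], of "{1/2<..}"] by simp
  next
    show "K \<subseteq> \<Union> (?V ` K)"
    proof
      fix p assume "p \<in> K"
      then have "p \<in> ?V p" using u(2) by (simp add: K_def)
      then show "p \<in> \<Union> (?V ` K)" using \<open>p \<in> K\<close> by blast
    qed
  qed
  then obtain \<F> where \<F>: "finite \<F>" "\<F> \<subseteq> ?V ` K" "K \<subseteq> \<Union>\<F>" by blast
  obtain T where T: "T \<subseteq> K" "finite T" and "\<F> = ?V ` T"
    using finite_subset_image[OF \<F>(1,2)] by blast
  then have KT: "K \<subseteq> \<Union> (?V ` T)" using \<F>(3) by simp
  define v where "v x = (\<Sum>p\<in>T. u p x)" for x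
  have v_nonneg: "0 \<le> v x" if "x \<in> topspace X" for x
    unfolding v_def using u(3) T that by (intro sum_nonneg) auto
  have v_half: "1/2 \<le> v x" if "x \<in> K" for x
  proof -
    have "x \<in> \<Union> (?V ` T)" using KT \<open>x \<in> K\<close> by (rule subsetD)
    then obtain p where p: "p \<in> T" "x \<in> topspace X" "1/2 < u p x" by auto
    then have "u p x \<le> v x"
      unfolding v_def using u(3) T by (intro member_le_sum) auto
    then show ?thesis using p by simp
  qed
  have v: "continuous_map X euclideanreal v"
    unfolding v_def using u(1) T by (intro continuous_map_sum) auto
  \<comment> \<open>This is \<open>1 / v\<close> on \<open>K\<close>; the maximum keeps the
    reciprocal continuous on all of \<open>X\<close> and \<open>v x * r x\<close> between 0 and
    1.\<close>
  define r where "r x = inverse (max (v x) (1/2))" for x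
  have r: "continuous_map X euclideanreal r"
    unfolding r_def using v by (intro continuous_map_real_inverse continuous_map_real_max) auto
  have r_complex: "continuous_map X euclidean (\<lambda>x. complex_of_real (r x))"
    using r by (rule continuous_map_complex_of_real)
  define \<psi> where "\<psi> x = \<phi> x * complex_of_real (r x)" for x
  have \<psi>: "continuous_map X euclidean \<psi>"
    unfolding \<psi>_def using \<phi> r_complex by (rule continuous_map_complex_mult)
  have u\<psi>: "continuous_map X euclidean (\<lambda>x. complex_of_real (u p x) * \<psi> x)" if "p \<in> T" for p
    using u(1) T that \<psi> by (intro continuous_map_complex_mult continuous_map_complex_of_real) auto
  \<comment> \<open>The function \<open>\<phi> * v * r\<close>, written as a sum of multiples of the
    \<open>u p\<close> so that \<open>L\<close> kills every summand.\<close>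
  let ?w = "\<lambda>x. \<Sum>p\<in>T. complex_of_real (u p x) * \<psi> x"
  have w: "continuous_map X euclidean ?w"
    using u\<psi> T by (intro continuous_map_sum) auto
  have "L ?w = 0"
    using T u\<psi> u(4) \<psi> by (subst sum) (auto intro!: sum.neutral)
  moreover have "L \<phi> = L (\<lambda>x. \<phi> x - ?w x) + L ?w"
    using add[of "\<lambda>x. \<phi> x - ?w x" ?w] \<phi> w by (simp add: continuous_map_diff)
  moreover have "cmod (\<phi> x - ?w x) \<le> \<delta>" if x: "x \<in> topspace X" for x
  proof -
    have eq: "\<phi> x - ?w x = \<phi> x * complex_of_real (1 - v x * r x)"
      by (simp add: \<psi>_def v_def algebra_simps sum_distrib_left sum_distrib_right)
    have vr: "0 \<le> 1 - v x * r x" "1 - v x * r x \<le> 1"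
      using v_nonneg[OF x] by (auto simp: r_def field_simps max_def)
    show ?thesis
    \<comment> \<open>On \<open>K\<close> the functions \<open>\<phi>\<close> and \<open>?w\<close>
      coincide; off \<open>K\<close> their difference is \<open>\<phi>\<close>, already small,
      scaled by a factor between 0 and 1.\<close>
    proof (cases "x \<in> K")
      case True
      then have "v x * r x = 1" using v_half[of x] by (simp add: r_def max_def)
      then show ?thesis using eq \<open>\<delta> > 0\<close> by simp
    next
      case False
      then have "cmod (\<phi> x) \<le> \<delta>" using x by (simp add: K_def)
      moreover have "cmod (\<phi> x - ?w x) \<le> cmod (\<phi> x) * 1"
        unfolding eq norm_mult norm_of_real using vr by (intro mult_left_mono) auto
      ultimately show ?thesis by simp
    qed
  qed
  ultimately show False
    using \<delta>[of "\<lambda>x. \<phi> x - ?w x"] \<phi> w by (simp add: continuous_map_diff)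
qed

lemma sum_mset_representation:
  obtains M where "size M = n" "set_mset M \<subseteq> topspace X"
    "\<And>\<phi>. continuous_map X euclidean \<phi> \<Longrightarrow> L \<phi> = (\<Sum>x\<in>#M. \<phi> x)"
proof -
  \<comment> \<open>Functions dual to the finitely many support points; the numbers
    \<open>L (e s)\<close> will be the multiplicities.\<close>
  have "\<forall>s\<in>support. \<exists>\<phi>. continuous_map X euclidean \<phi> \<and> \<phi> s = 1 \<and> (\<forall>t\<in>support - {s}. \<phi> t = (0::complex))"
    using finite_support
    by (intro ballI separating_function[OF compact Hausdorff]) (auto simp: support_def)
  from bchoice[OF this] obtain e where e: "\<And>s. s \<in> support \<Longrightarrow> continuous_map X euclidean (e s)"
    "\<And>s. s \<in> support \<Longrightarrow> e s s = (1::complex)"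
    "\<And>s t. s \<in> support \<Longrightarrow> t \<in> support \<Longrightarrow> t \<noteq> s \<Longrightarrow> e s t = 0"
    by auto
  have L_eq: "L \<phi> = (\<Sum>s\<in>support. \<phi> s * L (e s))" if \<phi>: "continuous_map X euclidean \<phi>" for \<phi>
  proof -
    let ?w = "\<lambda>x. \<Sum>s\<in>support. \<phi> s * e s x"
    have es: "continuous_map X euclidean (\<lambda>x. \<phi> s * e s x)" if "s \<in> support" for s
      using e(1)[OF that] by (intro continuous_map_complex_mult) auto
    have w: "continuous_map X euclidean ?w"
      using es finite_support by (intro continuous_map_sum) auto
    have "?w t = \<phi> t" if "t \<in> support" for t
    proof -
      have "?w t = (\<Sum>s\<in>support. if s = t then \<phi> t else 0)"
        using e that by (intro sum.cong) auto
      then show ?thesis using that finite_support by simp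
    qed
    \<comment> \<open>\<open>?w\<close> interpolates \<open>\<phi>\<close> on the support, and
      \<open>L\<close> ignores whatever vanishes there.\<close>
    then have "L (\<lambda>x. \<phi> x - ?w x) = 0"
      using \<phi> w by (intro eq_0_if_zero_on_support continuous_map_diff) auto
    then have "L \<phi> = L ?w"
      using add[of "\<lambda>x. \<phi> x - ?w x" ?w] \<phi> w by (simp add: continuous_map_diff)
    also have "\<dots> = (\<Sum>s\<in>support. \<phi> s * L (e s))"
      using es finite_support e(1) by (subst sum) (auto simp: scale)
    finally show ?thesis .
  qed
  have "\<exists>k. L (e s) = of_nat k" if s: "s \<in> support" for s
  proof -
    \<comment> \<open>On the support \<open>e s\<close> is idempotent, so its positive powers all
      have the same image under \<open>L\<close>; a nonempty \<open>\<gamma>\<close> excludes the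
      zeroth power.\<close>
    have "L (\<lambda>x. \<Prod>i\<in>\<gamma>. e s x) = L (e s)" if \<gamma>: "\<gamma> \<noteq> {}" "finite \<gamma>" for \<gamma> :: "nat set"
    proof -
      have "L (\<lambda>x. \<Prod>i\<in>\<gamma>. e s x) = (\<Sum>t\<in>support. (\<Prod>i\<in>\<gamma>. e s t) * L (e t))"
        using e(1)[OF s] by (intro L_eq continuous_map_complex_prod)
      also have "\<dots> = (\<Sum>t\<in>support. e s t * L (e t))"
      proof (rule sum.cong)
        fix t assume "t \<in> support"
        then have "e s t = 0 \<or> e s t = 1" using e s by metis
        then show "(\<Prod>i\<in>\<gamma>. e s t) * L (e t) = e s t * L (e t)"
          using \<gamma> by (auto simp: card_gt_0_iff)
      qed simp
      also have "\<dots> = L (e s)" using L_eq e(1)[OF s] by simp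
      finally show ?thesis .
    qed
    then have "(\<Prod>\<gamma>\<in>orbit \<sigma> ` {..<Suc n}. L (\<lambda>x. \<Prod>i\<in>\<gamma>. e s x)) = L (e s) ^ card (orbit \<sigma> ` {..<Suc n})"
      if \<sigma>: "\<sigma> permutes {..<Suc n}" for \<sigma>
    proof -
      have "finite (orbit \<sigma> i)" if "i < Suc n" for i
        using permutes_orbit_subset[OF \<sigma>, of i] that by (auto intro: finite_subset)
      then show ?thesis
        using \<open>\<And>\<gamma> :: nat set. \<gamma> \<noteq> {} \<Longrightarrow> finite \<gamma> \<Longrightarrow> L (\<lambda>x. \<Prod>i\<in>\<gamma>. e s x) = L (e s)\<close>
        by (subst prod_constant[symmetric], intro prod.cong) (auto simp: orbit_nonempty)
    qed
    \<comment> \<open>With every argument equal to \<open>e s\<close>, each cycle contributes one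
      factor \<open>L (e s)\<close>, so the Frobenius identity is the signed cycle polynomial at
      \<open>L (e s)\<close>, with roots \<open>0, ..., n\<close>.\<close>
    then have "(\<Prod>i<Suc n. L (e s) - of_nat i) = 0"
      using Frobenius[of "\<lambda>_. e s"] e(1)[OF s]
      by (simp flip: sum_sign_power_card_orbits)
    then show ?thesis by (auto simp: prod_zero_iff)
  qed
  then obtain c where c: "\<And>s. s \<in> support \<Longrightarrow> L (e s) = of_nat (c s)" by metis
  define M where "M = (\<Sum>s\<in>support. replicate_mset (c s) s)"
  have L_M: "L \<phi> = (\<Sum>x\<in>#M. \<phi> x)" if "continuous_map X euclidean \<phi>" for \<phi>
  proof -
    have "(\<Sum>x\<in>#(\<Sum>s\<in>I. replicate_mset (c s) s). \<phi> x) = (\<Sum>s\<in>I. \<phi> s * of_nat (c s))" if "finite I" for I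
      using that by induction (auto simp: mult.commute)
    then show ?thesis using L_eq[OF that] c finite_support by (simp add: M_def)
  qed
  \<comment> \<open>The constant function 1 counts the elements of \<open>M\<close>, and
    \<open>one\<close> gives its value under \<open>L\<close>.\<close>
  moreover have "size M = n"
    using L_M[of "\<lambda>_. 1"] one by (simp flip: size_eq_sum_mset of_nat_sum_mset)
  moreover have "set_mset M \<subseteq> topspace X"
    using finite_support by (auto simp: M_def set_mset_sum support_def)
  ultimately show ?thesis using that by blast
qed

end

section \<open>Multisets as functionals, and continuity into the symmetric product\<close>

lemma sum_mset_separates:
  assumes X: "compact_space X" "Hausdorff_space X"
    and MN: "set_mset M \<subseteq> topspace X" "set_mset N \<subseteq> topspace X"
    and eq: "\<And>\<phi> :: 'a \<Rightarrow> complex. continuous_map X euclidean \<phi> \<Longrightarrow> (\<Sum>x\<in>#M. \<phi> x) = (\<Sum>x\<in>#N. \<phi> x)"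
  shows "M = N"
proof (rule multiset_eqI)
  fix p
  show "count M p = count N p"
  proof (cases "p \<in># M + N")
    case False
    then show ?thesis by (simp add: not_in_iff)
  next
    case True
    let ?F = "set_mset (M + N) - {p}"
    have "finite ?F" "?F \<subseteq> topspace X" "p \<in> topspace X - ?F"
      using MN True by auto
    from separating_function[OF X this] obtain \<phi> :: "'a \<Rightarrow> complex"
      where \<phi>: "continuous_map X euclidean \<phi>" "\<phi> p = 1" "\<forall>x\<in>?F. \<phi> x = 0"
      by auto
    \<comment> \<open>Since \<open>\<phi>\<close> is 1 at \<open>p\<close> and 0 at all other points
      of both multisets, its sum reads off the multiplicity of \<open>p\<close>.\<close>
    have "(\<Sum>x\<in>#K. \<phi> x) = of_nat (count K p)" if "set_mset K \<subseteq> set_mset (M + N)" for K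
      using that by (induction K) (use \<phi> in auto)
    then show ?thesis using eq[OF \<phi>(1)] by simp
  qed
qed

text \<open>Evaluation at \<open>y\<close> is a unital algebra homomorphism to the complex numbers,
  and following a Frobenius homomorphism by such a map preserves the Frobenius condition.
  Restriction supplies the extensional representatives on which \<open>f\<close> acts.\<close>

lemma Frobenius_functional_eval:
  assumes X: "compact_space X" "Hausdorff_space X"
    and f: "Frobenius_hom n (Cfun X) (Cfun Y) f" and y: "y \<in> topspace Y"
    and small: "\<And>\<epsilon>. \<epsilon> > 0 \<Longrightarrow> \<exists>\<delta>>0. \<forall>\<phi>\<in>carrier (Cfun X).
      (\<forall>x\<in>topspace X. cmod (\<phi> x) \<le> \<delta>) \<longrightarrow> cmod (f \<phi> y) < \<epsilon>"
  shows "Frobenius_functional X n (\<lambda>\<phi>. f (restrict \<phi> (topspace X)) y)"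
proof
  note [simp] = continuous_map_restrict_topspace
  have lin: "linear_map (Cfun X) (Cfun Y) f"
    using f by (simp only: Frobenius_hom_def)
  show "compact_space X" "Hausdorff_space X" by (fact X)+
  show "f (restrict \<phi> (topspace X)) y = f (restrict \<psi> (topspace X)) y"
    if "\<And>x. x \<in> topspace X \<Longrightarrow> \<phi> x = \<psi> x" for \<phi> \<psi>
  proof -
    have "restrict \<phi> (topspace X) = restrict \<psi> (topspace X)"
      using that by (auto intro!: restrict_ext)
    then show ?thesis by (simp only:)
  qed
  show "f (\<lambda>x\<in>topspace X. \<phi> x + \<psi> x) y = f (restrict \<phi> (topspace X)) y + f (restrict \<psi> (topspace X)) y"
    if "continuous_map X euclidean \<phi>" "continuous_map X euclidean \<psi>" for \<phi> \<psi>
  proof -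
    have "(\<lambda>x\<in>topspace X. \<phi> x + \<psi> x) = restrict \<phi> (topspace X) \<oplus>\<^bsub>Cfun X\<^esub> restrict \<psi> (topspace X)"
      by (auto intro!: restrict_ext)
    moreover have "f (restrict \<phi> (topspace X) \<oplus>\<^bsub>Cfun X\<^esub> restrict \<psi> (topspace X))
        = f (restrict \<phi> (topspace X)) \<oplus>\<^bsub>Cfun Y\<^esub> f (restrict \<psi> (topspace X))"
      using lin that unfolding linear_map_def by (simp del: Cfun_simps(5))
    ultimately show ?thesis using y by simp
  qed
  show "f (\<lambda>x\<in>topspace X. c * \<phi> x) y = c * f (restrict \<phi> (topspace X)) y"
    if "continuous_map X euclidean \<phi>" for \<phi> c
  proof -
    have "(\<lambda>x\<in>topspace X. c * \<phi> x) = c \<odot>\<^bsub>Cfun X\<^esub> restrict \<phi> (topspace X)"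
      by (auto intro!: restrict_ext)
    moreover have "f (c \<odot>\<^bsub>Cfun X\<^esub> restrict \<phi> (topspace X)) = c \<odot>\<^bsub>Cfun Y\<^esub> f (restrict \<phi> (topspace X))"
      using lin that unfolding linear_map_def by (simp del: Cfun_simps(6))
    ultimately show ?thesis using y by simp
  qed
  show "\<exists>\<delta>>0. \<forall>\<phi>. continuous_map X euclidean \<phi> \<longrightarrow> (\<forall>x\<in>topspace X. cmod (\<phi> x) \<le> \<delta>) \<longrightarrow>
      cmod (f (restrict \<phi> (topspace X)) y) < \<epsilon>" if \<epsilon>: "\<epsilon> > 0" for \<epsilon>
  proof -
    obtain \<delta> where "\<delta> > 0" and \<delta>: "\<forall>\<phi>\<in>carrier (Cfun X).
      (\<forall>x\<in>topspace X. cmod (\<phi> x) \<le> \<delta>) \<longrightarrow> cmod (f \<phi> y) < \<epsilon>"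
      using small[OF \<epsilon>] by blast
    then show ?thesis by (intro exI[of _ \<delta>]) auto
  qed
  show "f (\<lambda>x\<in>topspace X. 1) y = of_nat n"
  proof -
    have "f \<one>\<^bsub>Cfun X\<^esub> = of_nat n \<odot>\<^bsub>Cfun Y\<^esub> \<one>\<^bsub>Cfun Y\<^esub>"
      using f by (simp only: Frobenius_hom_def)
    then show ?thesis using y by simp
  qed
  fix a :: "nat \<Rightarrow> 'a \<Rightarrow> complex"
  assume a: "\<And>i. i \<le> n \<Longrightarrow> continuous_map X euclidean (a i)"
  let ?a = "\<lambda>i. restrict (a i) (topspace X)"
  have carrier: "?a i \<in> carrier (Cfun X)" if "i < Suc n" for i
    using a that by simp
  have "Frobenius_Phi (Cfun X) (Cfun Y) (Suc n) f ?a y = 0"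
  proof -
    have "?a \<in> {..<Suc n} \<rightarrow> carrier (Cfun X)" using carrier by blast
    then have "Frobenius_Phi (Cfun X) (Cfun Y) (Suc n) f ?a = \<zero>\<^bsub>Cfun Y\<^esub>"
      using f unfolding Frobenius_hom_def by blast
    then show ?thesis using y by simp
  qed
  moreover have "f \<in> carrier (Cfun X) \<rightarrow> carrier (Cfun Y)"
    using lin by (simp only: linear_map_def)
  moreover have "(\<lambda>x\<in>topspace X. \<Prod>i\<in>\<gamma>. ?a i x) = (\<lambda>x\<in>topspace X. \<Prod>i\<in>\<gamma>. a i x)" for \<gamma>
    by (auto intro!: restrict_ext)
  ultimately show "(\<Sum>\<sigma> | \<sigma> permutes {..<Suc n}. of_int (sign \<sigma>) *
      (\<Prod>\<gamma>\<in>orbit \<sigma> ` {..<Suc n}. f (\<lambda>x\<in>topspace X. \<Prod>i\<in>\<gamma>. a i x) y)) = 0"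
    using Frobenius_Phi_Cfun[of f X Y "Suc n" ?a y] carrier y by simp
qed

text \<open>The supremum metric dominates each pointwise distance, so metric continuity at the zero
  function yields one \<open>\<delta>\<close> for all \<open>y\<close>.\<close>

lemma continuous_Cfun_top_at_zero:
  assumes XY: "compact_space X" "compact_space Y"
    and \<tau>: "continuous_map (Cfun_top X) (Cfun_top Y) \<tau>" "\<tau> \<zero>\<^bsub>Cfun X\<^esub> = \<zero>\<^bsub>Cfun Y\<^esub>"
    and "\<epsilon> > 0"
  obtains \<delta> where "\<delta> > 0" "\<And>\<phi> y. \<phi> \<in> carrier (Cfun X) \<Longrightarrow>
    (\<forall>x\<in>topspace X. cmod (\<phi> x) \<le> \<delta>) \<Longrightarrow> y \<in> topspace Y \<Longrightarrow> cmod (\<tau> \<phi> y) < \<epsilon>"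
proof -
  let ?mX = "cfunspace X (euclidean_metric :: complex metric)"
  let ?mY = "cfunspace Y (euclidean_metric :: complex metric)"
  have carrier: "mspace ?mX = carrier (Cfun X)" "mspace ?mY = carrier (Cfun Y)"
    using topspace_Cfun_top XY unfolding Cfun_top_def topspace_mtopology_of by blast+
  have zero: "\<zero>\<^bsub>Cfun X\<^esub> \<in> carrier (Cfun X)" "\<zero>\<^bsub>Cfun Y\<^esub> \<in> carrier (Cfun Y)"
    by (simp_all add: continuous_map_restrict_topspace)
  interpret mX: Metric_space "mspace ?mX" "mdist ?mX" by (rule Metric_space_mspace_mdist)
  have cont: "\<forall>a\<in>mspace ?mX. \<forall>\<epsilon>>0. \<exists>\<delta>>0. \<forall>x. x \<in> mspace ?mX \<and> mdist ?mX a x < \<delta> \<longrightarrow>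
      mdist ?mY (\<tau> a) (\<tau> x) < \<epsilon>" and img: "\<tau> ` mspace ?mX \<subseteq> mspace ?mY"
    using \<tau>(1) mX.metric_continuous_map[OF Metric_space_mspace_mdist, of ?mY \<tau>]
    unfolding Cfun_top_def mtopology_of_def by blast+
  obtain \<delta> where "\<delta> > 0" and \<delta>: "\<And>\<phi>. \<phi> \<in> mspace ?mX \<Longrightarrow> mdist ?mX \<zero>\<^bsub>Cfun X\<^esub> \<phi> < \<delta> \<Longrightarrow>
      mdist ?mY \<zero>\<^bsub>Cfun Y\<^esub> (\<tau> \<phi>) < \<epsilon>"
    using cont zero(1) \<open>\<epsilon> > 0\<close> \<tau>(2) carrier by metis
  show thesis
  proof (rule that)
    \<comment> \<open>Halving turns the non-strict pointwise bound into the strict inequality of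
      distances that \<open>\<delta>\<close> demands.\<close>
    show "\<delta> / 2 > 0" using \<open>\<delta> > 0\<close> by simp
    fix \<phi> y
    assume \<phi>: "\<phi> \<in> carrier (Cfun X)" and le: "\<forall>x\<in>topspace X. cmod (\<phi> x) \<le> \<delta> / 2"
      and y: "y \<in> topspace Y"
    have "mdist ?mX \<zero>\<^bsub>Cfun X\<^esub> \<phi> \<le> \<delta> / 2"
      using le \<open>\<delta> > 0\<close> by (intro mdist_cfunspace_le) (simp_all add: dist_norm)
    then have "mdist ?mY \<zero>\<^bsub>Cfun Y\<^esub> (\<tau> \<phi>) < \<epsilon>"
      using \<phi> carrier(1) \<open>\<delta> > 0\<close> by (intro \<delta>) auto
    moreover have "mdist euclidean_metric (\<zero>\<^bsub>Cfun Y\<^esub> y) (\<tau> \<phi> y) \<le> mdist ?mY \<zero>\<^bsub>Cfun Y\<^esub> (\<tau> \<phi>)"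
      using zero(2) \<phi> carrier img y by (intro mdist_cfunspace_imp_mdist_le[OF _ _ order_refl]) blast+
    ultimately show "cmod (\<tau> \<phi> y) < \<epsilon>"
      using y by (simp add: dist_norm)
  qed
qed

text \<open>The preimage of a closed set of multisets is the image of a closed subset of
  \<open>Y \<times> X\<^sup>n\<close> under the projection along the compact factor \<open>X\<^sup>n\<close>.\<close>

lemma continuous_map_Sym:
  assumes X: "compact_space X" "Hausdorff_space X"
    and t: "\<And>y. y \<in> topspace Y \<Longrightarrow> t y \<in> topspace (Sym n X)"
    and cont: "\<And>\<phi> :: 'a \<Rightarrow> complex. continuous_map X euclidean \<phi> \<Longrightarrow>
      continuous_map Y euclidean (\<lambda>y. \<Sum>x\<in>#t y. \<phi> x)"
  shows "continuous_map Y (Sym n X) t"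
  unfolding continuous_map_closedin
proof (intro conjI allI impI)
  show "t \<in> topspace Y \<rightarrow> topspace (Sym n X)" using t by blast
  fix C assume C: "closedin (Sym n X) C"
  let ?P = "product_topology (\<lambda>_. X) {..<n}"
  let ?Z = "prod_topology Y ?P"
  let ?C = "{\<phi> :: 'a \<Rightarrow> complex. continuous_map X euclidean \<phi>}"
  let ?d = "\<lambda>\<phi> z. (\<Sum>x\<in>#t (fst z). \<phi> x) - (\<Sum>i<n. \<phi> (snd z i))"
  define A where "A = {z \<in> topspace ?Z. tuple_mset n (snd z) \<in> C}"
  \<comment> \<open>By \<open>sum_mset_separates\<close>, \<open>E\<close> consists of the pairs
    \<open>(y, v)\<close> with \<open>t y = tuple_mset n v\<close>. Described by test functions, it
    is an intersection of zero sets and so visibly closed.\<close>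
  define E where "E = (\<Inter>\<phi>\<in>?C. {z \<in> topspace ?Z. ?d \<phi> z \<in> {0}})"
  have "continuous_map ?Z (Sym n X) (tuple_mset n \<circ> snd)"
    using quotient_map_Sym by (intro continuous_map_compose[OF continuous_map_snd] quotient_imp_continuous_map)
  from closedin_continuous_map_preimage[OF this C] have A: "closedin ?Z A"
    unfolding A_def comp_def .
  have E: "closedin ?Z E"
    unfolding E_def
  proof (rule closedin_INT)
    have "(\<lambda>_. 0) \<in> ?C" by simp
    then show "?C \<noteq> {}" by blast
    fix \<phi> assume "\<phi> \<in> ?C"
    then have \<phi>: "continuous_map X euclidean \<phi>" by simp
    have "continuous_map ?Z euclidean (\<lambda>z. \<Sum>x\<in>#t (fst z). \<phi> x)"
      using continuous_map_compose[OF continuous_map_fst cont[OF \<phi>], of ?P] by (simp add: comp_def)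
    moreover have "continuous_map ?Z euclidean (\<lambda>z. \<phi> (snd z i))" if "i < n" for i
    proof -
      have "continuous_map ?P X (\<lambda>v. v i)"
        using that by (intro continuous_map_product_projection) simp
      from continuous_map_compose[OF continuous_map_compose[OF continuous_map_snd this] \<phi>, of Y]
      show ?thesis by (simp add: comp_def)
    qed
    ultimately have "continuous_map ?Z euclidean (?d \<phi>)"
      by (intro continuous_map_diff continuous_map_sum) auto
    then show "closedin ?Z {z \<in> topspace ?Z. ?d \<phi> z \<in> {0}}"
      by (rule closedin_continuous_map_preimage) simp
  qed
  have sum_tuple: "(\<Sum>x\<in>#tuple_mset n v. \<phi> x) = (\<Sum>i<n. \<phi> (v i))" for v and \<phi> :: "'a \<Rightarrow> complex"
    by (simp add: tuple_mset_def sum_unfold_sum_mset multiset.map_comp comp_def)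
  have "compact_space ?P"
    using X by (simp add: compact_space_product_topology)
  then have "closed_map ?Z Y fst" by (rule Abstract_Topological_Spaces.closed_map_fst)
  then have "closedin Y (fst ` (A \<inter> E))"
    using A E unfolding closed_map_def by (meson closedin_Int)
  also have "fst ` (A \<inter> E) = {y \<in> topspace Y. t y \<in> C}"
  proof (intro equalityI subsetI)
    fix y assume "y \<in> fst ` (A \<inter> E)"
    then obtain v where z: "(y, v) \<in> topspace ?Z" "tuple_mset n v \<in> C" "(y, v) \<in> E"
      by (auto simp: A_def)
    then have y: "y \<in> topspace Y" and v: "v \<in> topspace ?P" by auto
    have "t y = tuple_mset n v"
    proof (rule sum_mset_separates[OF X])
      show "set_mset (t y) \<subseteq> topspace X" using t[OF y] by (simp add: topspace_Sym)
      show "set_mset (tuple_mset n v) \<subseteq> topspace X" using v by (auto simp: PiE_iff)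
      show "(\<Sum>x\<in>#t y. \<phi> x) = (\<Sum>x\<in>#tuple_mset n v. \<phi> x)"
        if "continuous_map X euclidean \<phi>" for \<phi> :: "'a \<Rightarrow> complex"
        using z(3) that by (simp add: E_def sum_tuple)
    qed
    then show "y \<in> {y \<in> topspace Y. t y \<in> C}" using y z by simp
  next
    fix y assume "y \<in> {y \<in> topspace Y. t y \<in> C}"
    then have y: "y \<in> topspace Y" "t y \<in> C" by auto
    \<comment> \<open>Surjectivity of the quotient map supplies an ordering \<open>v\<close> of
      \<open>t y\<close>, which puts \<open>(y, v)\<close> into both closed sets.\<close>
    have "t y \<in> tuple_mset n ` topspace ?P"
      using t[OF y(1)] quotient_imp_surjective_map[OF quotient_map_Sym, of n X] by simp
    then obtain v where v: "v \<in> topspace ?P" "t y = tuple_mset n v" by blast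
    have "(y, v) \<in> A" using v y by (simp add: A_def)
    moreover have "(y, v) \<in> E" using v y by (simp add: E_def sum_tuple)
    ultimately show "y \<in> fst ` (A \<inter> E)" by force
  qed
  finally show "closedin Y {y \<in> topspace Y. t y \<in> C}" .
qed

section \<open>Transfers and branched coverings\<close>

theorem theorem5p2:
  fixes X :: "'a topology" and Y :: "'b topology"
    and h :: "'a \<Rightarrow> 'b" and n :: nat
    and \<tau> :: "('a \<Rightarrow> complex) \<Rightarrow> ('b \<Rightarrow> complex)"
  assumes "compact_space X" and "Hausdorff_space X"
    and "compact_space Y" and "Hausdorff_space Y"
    and "continuous_map X Y h"
    and "transfer n (Cfun Y) (Cfun X) (pullback X h) \<tau>"
    and "continuous_map (Cfun_top X) (Cfun_top Y) \<tau>"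
  shows "branched_covering n X Y h"
proof -
  note X = assms(1,2) and Y = assms(3,4)
  have h: "h x \<in> topspace Y" if "x \<in> topspace X" for x
    using assms(5) that by (auto simp: continuous_map_def)
  have Frob: "Frobenius_hom n (Cfun X) (Cfun Y) \<tau>"
    and proj: "\<And>\<psi> \<phi>. \<psi> \<in> carrier (Cfun Y) \<Longrightarrow> \<phi> \<in> carrier (Cfun X) \<Longrightarrow>
      \<tau> (pullback X h \<psi> \<otimes>\<^bsub>Cfun X\<^esub> \<phi>) = \<psi> \<otimes>\<^bsub>Cfun Y\<^esub> \<tau> \<phi>"
    using assms(6) unfolding transfer_def by blast+
  obtain m g where Frob_g: "Frobenius_hom m (Cfun X) (Cfun X) g"
    and g: "\<And>\<phi>. \<phi> \<in> carrier (Cfun X) \<Longrightarrow> pullback X h (\<tau> \<phi>) = \<phi> \<oplus>\<^bsub>Cfun X\<^esub> g \<phi>"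
    using assms(6) unfolding transfer_def by blast
  have carrier: "restrict \<phi> (topspace Z) \<in> carrier (Cfun Z)" if "continuous_map Z euclidean \<phi>"
    for Z :: "'c topology" and \<phi>
    using that by (simp add: continuous_map_restrict_topspace)
  have \<tau>_carrier: "\<tau> \<phi> \<in> carrier (Cfun Y)" if "\<phi> \<in> carrier (Cfun X)" for \<phi>
    using Frob that unfolding Frobenius_hom_def linear_map_def by blast
  have \<tau>_zero: "\<tau> \<zero>\<^bsub>Cfun X\<^esub> = \<zero>\<^bsub>Cfun Y\<^esub>"
  proof -
    have "\<zero>\<^bsub>Cfun X\<^esub> \<in> carrier (Cfun X)" by (simp add: continuous_map_restrict_topspace)
    moreover from this have "\<tau> (0 \<odot>\<^bsub>Cfun X\<^esub> \<zero>\<^bsub>Cfun X\<^esub>) = 0 \<odot>\<^bsub>Cfun Y\<^esub> \<tau> \<zero>\<^bsub>Cfun X\<^esub>"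
      using Frob unfolding Frobenius_hom_def linear_map_def by blast
    moreover have "0 \<odot>\<^bsub>Cfun X\<^esub> \<zero>\<^bsub>Cfun X\<^esub> = \<zero>\<^bsub>Cfun X\<^esub>" by (auto intro!: restrict_ext)
    ultimately show ?thesis by simp
  qed
  have \<tau>_small: "\<exists>\<delta>>0. \<forall>\<phi>\<in>carrier (Cfun X). (\<forall>x\<in>topspace X. cmod (\<phi> x) \<le> \<delta>) \<longrightarrow> cmod (\<tau> \<phi> y) < \<epsilon>"
    if "y \<in> topspace Y" "\<epsilon> > 0" for y \<epsilon>
    using continuous_Cfun_top_at_zero[OF X(1) Y(1) assms(7) \<tau>_zero \<open>\<epsilon> > 0\<close>] that(1) by metis
  \<comment> \<open>Condition (iii) of a transfer, evaluated at \<open>x\<close> and solved for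
    \<open>g\<close>.\<close>
  have g_eq: "g \<phi> x = \<tau> \<phi> (h x) - \<phi> x" if "\<phi> \<in> carrier (Cfun X)" "x \<in> topspace X" for \<phi> x
    using fun_cong[OF g[OF that(1)], of x] that(2) by (simp add: pullback_def)
  \<comment> \<open>Continuity of \<open>g\<close> at zero is inherited from \<open>\<tau>\<close>;
    half of \<open>\<epsilon>\<close> is spent on \<open>\<tau> \<phi> (h x)\<close> and half on
    \<open>\<phi> x\<close>.\<close>
  have g_small: "\<exists>\<delta>>0. \<forall>\<phi>\<in>carrier (Cfun X). (\<forall>x\<in>topspace X. cmod (\<phi> x) \<le> \<delta>) \<longrightarrow> cmod (g \<phi> x) < \<epsilon>"
    if x: "x \<in> topspace X" and \<epsilon>: "\<epsilon> > 0" for x \<epsilon>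
  proof -
    obtain \<delta> where "\<delta> > 0" and \<delta>: "\<forall>\<phi>\<in>carrier (Cfun X).
        (\<forall>x\<in>topspace X. cmod (\<phi> x) \<le> \<delta>) \<longrightarrow> cmod (\<tau> \<phi> (h x)) < \<epsilon> / 2"
      using \<tau>_small[OF h[OF x], of "\<epsilon> / 2"] \<epsilon> by auto
    have "cmod (g \<phi> x) < \<epsilon>"
      if \<phi>: "\<phi> \<in> carrier (Cfun X)" and le: "\<forall>x\<in>topspace X. cmod (\<phi> x) \<le> min \<delta> (\<epsilon> / 2)" for \<phi>
    proof -
      have "cmod (\<tau> \<phi> (h x)) < \<epsilon> / 2" "cmod (\<phi> x) \<le> \<epsilon> / 2"
        using \<delta> \<phi> le x by auto
      then show ?thesis
        using norm_triangle_ineq4[of "\<tau> \<phi> (h x)" "\<phi> x"] g_eq[OF \<phi> x] by simp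
    qed
    then show ?thesis using \<open>\<delta> > 0\<close> \<epsilon> by (intro exI[of _ "min \<delta> (\<epsilon> / 2)"]) simp
  qed
  have "\<forall>y\<in>topspace Y. \<exists>M. size M = n \<and> set_mset M \<subseteq> topspace X \<and>
      (\<forall>\<phi>. continuous_map X euclidean \<phi> \<longrightarrow> \<tau> (restrict \<phi> (topspace X)) y = (\<Sum>x\<in>#M. \<phi> x))"
  proof
    fix y assume "y \<in> topspace Y"
    then interpret Frobenius_functional X n "\<lambda>\<phi>. \<tau> (restrict \<phi> (topspace X)) y"
      by (intro Frobenius_functional_eval[OF X Frob] \<tau>_small)
    show "\<exists>M. size M = n \<and> set_mset M \<subseteq> topspace X \<and>
      (\<forall>\<phi>. continuous_map X euclidean \<phi> \<longrightarrow> \<tau> (restrict \<phi> (topspace X)) y = (\<Sum>x\<in>#M. \<phi> x))"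
      using sum_mset_representation by metis
  qed
  from bchoice[OF this] obtain t where t: "\<And>y. y \<in> topspace Y \<Longrightarrow> size (t y) = n"
    "\<And>y. y \<in> topspace Y \<Longrightarrow> set_mset (t y) \<subseteq> topspace X"
    and \<tau>_t: "\<And>y \<phi>. y \<in> topspace Y \<Longrightarrow> continuous_map X euclidean \<phi> \<Longrightarrow>
      \<tau> (restrict \<phi> (topspace X)) y = (\<Sum>x\<in>#t y. \<phi> x)"
    by blast
  have "continuous_map Y (Sym n X) t"
  proof (rule continuous_map_Sym[OF X])
    show "t y \<in> topspace (Sym n X)" if "y \<in> topspace Y" for y
      using t that by (simp add: topspace_Sym)
    show "continuous_map Y euclidean (\<lambda>y. \<Sum>x\<in>#t y. \<phi> x)" if "continuous_map X euclidean \<phi>"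
      for \<phi> :: "'a \<Rightarrow> complex"
    \<comment> \<open>By \<open>\<tau>_t\<close> this function of \<open>y\<close> is the image
      under \<open>\<tau>\<close> of the restricted \<open>\<phi>\<close>, an element of
      \<open>C(Y)\<close>.\<close>
    proof (rule continuous_map_eq)
      show "continuous_map Y euclidean (\<tau> (restrict \<phi> (topspace X)))"
        using \<tau>_carrier[OF carrier[OF that]] by simp
    qed (use \<tau>_t that in auto)
  qed
  moreover have "x \<in># t (h x)" if x: "x \<in> topspace X" for x
  proof -
    interpret Frobenius_functional X m "\<lambda>\<phi>. g (restrict \<phi> (topspace X)) x"
      using x by (intro Frobenius_functional_eval[OF X Frob_g] g_small)
    obtain N where N: "set_mset N \<subseteq> topspace X" and
      g_N: "\<And>\<phi>. continuous_map X euclidean \<phi> \<Longrightarrow> g (restrict \<phi> (topspace X)) x = (\<Sum>x\<in>#N. \<phi> x)"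
      using sum_mset_representation by metis
    \<comment> \<open>At \<open>x\<close>, condition (iii) says that \<open>\<tau>\<close> at
      \<open>h x\<close> is evaluation at \<open>x\<close> plus the functional of \<open>g\<close>;
      as multisets, \<open>N\<close> gains the point \<open>x\<close>.\<close>
    have "t (h x) = add_mset x N"
    proof (rule sum_mset_separates[OF X])
      show "set_mset (t (h x)) \<subseteq> topspace X" using t h x by simp
      show "set_mset (add_mset x N) \<subseteq> topspace X" using N x by simp
      show "(\<Sum>x\<in>#t (h x). \<phi> x) = (\<Sum>x\<in>#add_mset x N. \<phi> x)"
        if "continuous_map X euclidean \<phi>" for \<phi> :: "'a \<Rightarrow> complex"
        using g_eq[OF carrier[OF that] x] g_N[OF that] \<tau>_t[OF h[OF x] that] x by simp
    qed
    then show ?thesis by simp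
  qed
  moreover have "Sym_map h (t y) = replicate_mset n y" if y: "y \<in> topspace Y" for y
    unfolding Sym_map_def
  proof (rule sum_mset_separates[OF Y])
    show "set_mset (image_mset h (t y)) \<subseteq> topspace Y" using t[OF y] h by auto
    show "set_mset (replicate_mset n y) \<subseteq> topspace Y" using y by auto
    fix \<psi> :: "'b \<Rightarrow> complex" assume \<psi>: "continuous_map Y euclidean \<psi>"
    have \<psi>h: "continuous_map X euclidean (\<lambda>x. \<psi> (h x))"
      using continuous_map_compose[OF assms(5) \<psi>] by (simp add: comp_def)
    have one: "\<one>\<^bsub>Cfun X\<^esub> \<in> carrier (Cfun X)" by (simp add: continuous_map_restrict_topspace)
    have "(\<Sum>x\<in>#image_mset h (t y). \<psi> x) = (\<Sum>x\<in>#t y. \<psi> (h x))"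
      by (simp add: multiset.map_comp comp_def)
    also have "\<dots> = \<tau> (\<lambda>x\<in>topspace X. \<psi> (h x)) y"
      using \<tau>_t[OF y \<psi>h] by simp
    \<comment> \<open>Writing the pullback as a product with 1 lets condition (ii) move
      \<open>\<psi>\<close> out of \<open>\<tau>\<close>, leaving \<open>\<tau> 1 = n\<close> and
      hence the value \<open>n * \<psi> y\<close>.\<close>
    also have "(\<lambda>x\<in>topspace X. \<psi> (h x)) = pullback X h (restrict \<psi> (topspace Y)) \<otimes>\<^bsub>Cfun X\<^esub> \<one>\<^bsub>Cfun X\<^esub>"
      using h by (auto simp: pullback_def intro!: restrict_ext)
    also have "\<tau> \<dots> = restrict \<psi> (topspace Y) \<otimes>\<^bsub>Cfun Y\<^esub> \<tau> \<one>\<^bsub>Cfun X\<^esub>"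
      by (rule proj[OF carrier[OF \<psi>] one])
    also have "\<tau> \<one>\<^bsub>Cfun X\<^esub> = of_nat n \<odot>\<^bsub>Cfun Y\<^esub> \<one>\<^bsub>Cfun Y\<^esub>"
      using Frob by (simp only: Frobenius_hom_def)
    finally show "(\<Sum>x\<in>#image_mset h (t y). \<psi> x) = (\<Sum>x\<in>#replicate_mset n y. \<psi> x)"
      using y by simp
  qed
  ultimately show ?thesis
    using X Y assms(5) unfolding branched_covering_def by blast
qed

end
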